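(* Let $(\mathcal G,z)$ be a canvas such that $\deg(A)\ge 4+|\tau(A)|$ for every non-empty $A\subsetneq V(\mathcal G)\setminus\{z\}$. If there exists a vertex $x\in V(\mathcal G)\setminus\{z\}$ such that $\deg(X)>\deg(z)-2$ for every $X\subseteq V(\mathcal G)\setminus\{z\}$ containing $x$, then every tip preflow extends to a nowhere-zero flow in $\mathcal G$.
   Context: Graphs are finite, loopless, and may have parallel edges. A $\mathbb{Z}_3$-boundary of a graph $G$ is a map $\beta:V(G)\to\mathbb{Z}_3$ with $\sum_{v\in V(C)}\beta(v)=0$ for every component $C$ of $G$; $\mathcal G=(G,\beta)$ is then a $\mathbb{Z}_3$-bordered graph. A nowhere-zero flow in $(G,\beta)$ is an orientation of $G$ with $\deg^+(v)-\deg^-(v)\equiv\beta(v)\pmod 3$ for every $v$. For $A\subseteq V(G)$, $\deg(A)$ is the number of edges with exactly one end in $A$, $\beta(A)=\sum_{v\in A}\beta(v)$, and $|\tau(A)|$ equals $0$ if $\deg(A)$ is even and $\beta(A)=0$; $2$ if $\deg(A)$ is even and $\beta(A)\neq 0$; $3$ if $\deg(A)$ is odd and $\beta(A)=0$; $1$ if $\deg(A)$ is odd and $\beta(A)\neq 0$. A canvas $(\mathcal G,z)$ is a $\mathbb{Z}_3$-bordered graph with a distinguished vertex $z$. A tip preflow is an orientation $\psi$ of the edges incident with $z$ such that (counting in $\psi$) $\deg^+(z)-\deg^-(z)\equiv \beta(z)\pmod 3$; it extends to a nowhere-zero flow in $\mathcal G$ if some nowhere-zero flow agrees with $\psi$ on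 all edges incident with $z$. *)

theory Defs
  imports Complex_Main "HOL-Library.Numeral_Type"
begin

record ('v, 'e) mgraph =
  verts :: "'v set"
  edges :: "'e set"
  ends :: "'e \<Rightarrow> 'v set"

definition graph :: "('v, 'e) mgraph \<Rightarrow> bool" where
  "graph G \<longleftrightarrow> finite (verts G) \<and> finite (edges G) \<and>
     (\<forall>e\<in>edges G. ends G e \<subseteq> verts G \<and> card (ends G e) = 2)"

definition adjacency :: "('v, 'e) mgraph \<Rightarrow> ('v \<times> 'v) set" where
  "adjacency G = {(u, v). \<exists>e\<in>edges G. ends G e = {u, v}}"

definition components :: "('v, 'e) mgraph \<Rightarrow> 'v set set" where
  "components G = {{v \<in> verts G. (u, v) \<in> (adjacency G)\<^sup>*} | u. u \<in> verts G}"

text \<open>The numeral type \<^typ>\<open>3\<close> is the ring of integers modulo 3.\<close>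

definition Z3_boundary :: "('v, 'e) mgraph \<Rightarrow> ('v \<Rightarrow> 3) \<Rightarrow> bool" where
  "Z3_boundary G \<beta> \<longleftrightarrow> (\<forall>C\<in>components G. (\<Sum>v\<in>C. \<beta> v) = 0)"

definition canvas :: "('v, 'e) mgraph \<Rightarrow> ('v \<Rightarrow> 3) \<Rightarrow> 'v \<Rightarrow> bool" where
  "canvas G \<beta> z \<longleftrightarrow> graph G \<and> Z3_boundary G \<beta> \<and> z \<in> verts G"

definition deg :: "('v, 'e) mgraph \<Rightarrow> 'v set \<Rightarrow> nat" where
  "deg G A = card {e \<in> edges G. card (ends G e \<inter> A) = 1}"

definition incident_edges :: "('v, 'e) mgraph \<Rightarrow> 'v \<Rightarrow> 'e set" where
  "incident_edges G v = {e \<in> edges G. v \<in> ends G e}"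

definition vdeg :: "('v, 'e) mgraph \<Rightarrow> 'v \<Rightarrow> nat" where
  "vdeg G v = card (incident_edges G v)"

definition abs_tau :: "('v, 'e) mgraph \<Rightarrow> ('v \<Rightarrow> 3) \<Rightarrow> 'v set \<Rightarrow> nat" where
  "abs_tau G \<beta> A =
     (if even (deg G A) then (if (\<Sum>v\<in>A. \<beta> v) = 0 then 0 else 2)
      else (if (\<Sum>v\<in>A. \<beta> v) = 0 then 3 else 1))"

text \<open>An orientation of the edges in \<open>F\<close> sends each of them to its pair (tail, head);
  its values outside \<open>F\<close> are irrelevant.\<close>

definition orientation_on :: "('v, 'e) mgraph \<Rightarrow> 'e set \<Rightarrow> ('e \<Rightarrow> 'v \<times> 'v) \<Rightarrow> bool" where
  "orientation_on G F D \<longleftrightarrow> (\<forall>e\<in>F. {fst (D e), snd (D e)} = ends G e)"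

definition outdeg :: "'e set \<Rightarrow> ('e \<Rightarrow> 'v \<times> 'v) \<Rightarrow> 'v \<Rightarrow> nat" where
  "outdeg F D v = card {e \<in> F. fst (D e) = v}"

definition indeg :: "'e set \<Rightarrow> ('e \<Rightarrow> 'v \<times> 'v) \<Rightarrow> 'v \<Rightarrow> nat" where
  "indeg F D v = card {e \<in> F. snd (D e) = v}"

definition nowhere_zero_flow ::
  "('v, 'e) mgraph \<Rightarrow> ('v \<Rightarrow> 3) \<Rightarrow> ('e \<Rightarrow> 'v \<times> 'v) \<Rightarrow> bool" where
  "nowhere_zero_flow G \<beta> \<phi> \<longleftrightarrow> orientation_on G (edges G) \<phi> \<and>
     (\<forall>v\<in>verts G. of_nat (outdeg (edges G) \<phi> v) - of_nat (indeg (edges G) \<phi> v) = \<beta> v)"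

definition tip_preflow ::
  "('v, 'e) mgraph \<Rightarrow> ('v \<Rightarrow> 3) \<Rightarrow> 'v \<Rightarrow> ('e \<Rightarrow> 'v \<times> 'v) \<Rightarrow> bool" where
  "tip_preflow G \<beta> z \<psi> \<longleftrightarrow> orientation_on G (incident_edges G z) \<psi> \<and>
     of_nat (outdeg (incident_edges G z) \<psi> z) - of_nat (indeg (incident_edges G z) \<psi> z) = \<beta> z"

definition extends_to_flow ::
  "('v, 'e) mgraph \<Rightarrow> ('v \<Rightarrow> 3) \<Rightarrow> 'v \<Rightarrow> ('e \<Rightarrow> 'v \<times> 'v) \<Rightarrow> bool" where
  "extends_to_flow G \<beta> z \<psi> \<longleftrightarrow>
     (\<exists>\<phi>. nowhere_zero_flow G \<beta> \<phi> \<and> (\<forall>e\<in>incident_edges G z. \<phi> e = \<psi> e))"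

end

theory Submission
  imports Defs
begin

text \<open>
  Forget the tip \<open>z\<close>: of its pre-oriented edges keep only, at every other vertex, how many enter and
  how many leave it. What remains is an orientation problem on \<open>G - z\<close> with prescribed boundary
  modulo 3, and deleting or reversing an edge at \<open>z\<close> does not change that problem, it only changes
  the certificate \<open>deg A \<ge> 4 + |\<tau>(A)|\<close>, which just says that \<open>deg A \<ge> 4\<close>, with \<open>\<beta>(A) = 0\<close> if
  \<open>deg A = 4\<close> and \<open>\<beta>(A) \<noteq> 0\<close> if \<open>deg A = 5\<close>.

  For the induction the hypothesis on \<open>x\<close> is weakened: if \<open>deg z = 7\<close>, two vertices \<open>x\<close>, \<open>y\<close> also
  suffice such that sets containing one of them have degree at least 5 and sets containing both have
  degree at least 6. Take a minimal counterexample. Contracting a set \<open>A\<close> and then its complement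
  shows that all sets with at least two vertices have large degree; parallel edges away from \<open>z\<close>
  can be contracted; a vertex of degree 4 can be split off. So all vertices have degree at least 5
  and larger sets have degree at least 8. Now pick an edge from \<open>z\<close> to \<open>v\<close> (or, symmetrically,
  from \<open>v\<close> to \<open>z\<close>). If it cannot be deleted, then \<open>v\<close> has degree 5 and \<open>\<beta>(v) = 1\<close>, or degree 6 and
  \<open>\<beta>(v) = -1\<close>; if no edge from \<open>v\<close> can be deleted after orienting it away from \<open>v\<close>, then all
  neighbours of \<open>v\<close> are of this kind too. In degree 6 we reverse the edge from \<open>z\<close> and delete an edge
  oriented towards \<open>v\<close>; in degree 5 we orient all five edges towards \<open>v\<close> and delete \<open>v\<close>.
\<close>

subsection \<open>Nets and contraction\<close>

text \<open>A graph without its tip. The numbers of tip edges into and out of \<open>v\<close> are \<open>pin v\<close> and \<open>pout v\<close>;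
  \<open>bd v\<close> is the required boundary modulo 3 after their removal, so that \<open>bd v - pin v + pout v\<close>
  represents \<open>\<beta>(v)\<close>. Loops are allowed, which makes contraction a mere relabelling of ends.\<close>

record ('v, 'e) net =
  nV :: "'v set"
  nE :: "'e set"
  tail :: "'e \<Rightarrow> 'v"
  head :: "'e \<Rightarrow> 'v"
  pin :: "'v \<Rightarrow> nat"
  pout :: "'v \<Rightarrow> nat"
  bd :: "'v \<Rightarrow> int"

definition dgr :: "('v, 'e) net \<Rightarrow> 'v set \<Rightarrow> nat" where
  "dgr N X = (\<Sum>e\<in>nE N. of_bool ((tail N e \<in> X) \<noteq> (head N e \<in> X))) + (\<Sum>v\<in>X. pin N v + pout N v)"

definition bet :: "('v, 'e) net \<Rightarrow> 'v set \<Rightarrow> int" where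
  "bet N X = (\<Sum>v\<in>X. bd N v - int (pin N v) + int (pout N v))"

definition tipdeg :: "('v, 'e) net \<Rightarrow> nat" where
  "tipdeg N = (\<Sum>v\<in>nV N. pin N v + pout N v)"

text \<open>A loop gets the value 0, so the loops that contraction creates may carry any
  sign.\<close>

definition inc :: "('v, 'e) net \<Rightarrow> 'e \<Rightarrow> 'v \<Rightarrow> int" where
  "inc N e v = of_bool (tail N e = v) - of_bool (head N e = v)"

definition flow :: "('v, 'e) net \<Rightarrow> ('e \<Rightarrow> int) \<Rightarrow> bool" where
  "flow N f \<longleftrightarrow> (\<forall>e\<in>nE N. f e = 1 \<or> f e = -1) \<and>
     (\<forall>v\<in>nV N. 3 dvd (\<Sum>e\<in>nE N. f e * inc N e v) - bd N v)"

definition wf_net :: "('v, 'e) net \<Rightarrow> bool" where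
  "wf_net N \<longleftrightarrow> finite (nV N) \<and> finite (nE N) \<and>
     (\<forall>e\<in>nE N. tail N e \<in> nV N \<and> head N e \<in> nV N) \<and> 3 dvd (\<Sum>v\<in>nV N. bd N v)"

definition fine :: "nat \<Rightarrow> int \<Rightarrow> bool" where
  "fine d s \<longleftrightarrow> 4 \<le> d \<and> (d = 4 \<longrightarrow> 3 dvd s) \<and> (d = 5 \<longrightarrow> \<not> 3 dvd s)"

definition good :: "('v, 'e) net \<Rightarrow> bool" where
  "good N \<longleftrightarrow> (\<forall>X\<subseteq>nV N. X \<noteq> {} \<and> X \<noteq> nV N \<longrightarrow> fine (dgr N X) (bet N X))"

text \<open>The \<open>+ 1\<close> states \<open>dgr N X > k - 2\<close> without subtraction. The
  number \<open>k\<close> is a parameter because a proper subset \<open>A\<close> is tested against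
  its own degree, which becomes the tip degree after restriction to \<open>A\<close>.\<close>

definition anchored :: "('v, 'e) net \<Rightarrow> 'v set \<Rightarrow> nat \<Rightarrow> bool" where
  "anchored N A k \<longleftrightarrow> (\<exists>x\<in>A. \<forall>X\<subseteq>A. x \<in> X \<longrightarrow> k \<le> dgr N X + 1)"

text \<open>A set containing only one of the two vertices may have degree 5, one less than
  \<open>anchored\<close> demands for \<open>k = 7\<close>.\<close>

definition twin_anchored :: "('v, 'e) net \<Rightarrow> 'v set \<Rightarrow> nat \<Rightarrow> bool" where
  "twin_anchored N A k \<longleftrightarrow> k = 7 \<and> (\<exists>x\<in>A. \<exists>y\<in>A. x \<noteq> y \<and>
     (\<forall>X\<subseteq>A. (x \<in> X \<or> y \<in> X \<longrightarrow> 5 \<le> dgr N X) \<and> (x \<in> X \<and> y \<in> X \<longrightarrow> 6 \<le> dgr N X)))"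

definition admissible :: "('v, 'e) net \<Rightarrow> bool" where
  "admissible N \<longleftrightarrow> wf_net N \<and> good N \<and>
     (anchored N (nV N) (tipdeg N) \<or> twin_anchored N (nV N) (tipdeg N))"

text \<open>The weight 2 pays for restricting to a vertex set, where every cut edge becomes a tip edge.\<close>

definition net_size :: "('v, 'e) net \<Rightarrow> nat" where
  "net_size N = 2 * card (nE N) + card (nV N) + tipdeg N"

text \<open>An edge between \<open>v\<close> and \<open>X\<close> counts for both \<open>X\<close>
  and \<open>{v}\<close> but not for their union; all other edges and all tip edges contribute
  equally to the two sides.\<close>

lemma dgr_insert:
  assumes "finite X" "v \<notin> X"
  shows "dgr N (insert v X) +
      2 * (\<Sum>e\<in>nE N. of_bool (tail N e = v \<and> head N e \<in> X \<or> head N e = v \<and> tail N e \<in> X))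
    = dgr N X + dgr N {v}"
proof -
  have "(\<Sum>e\<in>nE N. of_bool ((tail N e \<in> insert v X) \<noteq> (head N e \<in> insert v X)) +
        2 * of_bool (tail N e = v \<and> head N e \<in> X \<or> head N e = v \<and> tail N e \<in> X) :: nat)
    = (\<Sum>e\<in>nE N. of_bool ((tail N e \<in> X) \<noteq> (head N e \<in> X)) + of_bool ((tail N e \<in> {v}) \<noteq> (head N e \<in> {v})))"
    using assms by (intro sum.cong) auto
  then show ?thesis
    using assms by (simp add: dgr_def sum.distrib sum_distrib_left)
qed

lemma bet_insert:
  "finite X \<Longrightarrow> v \<notin> X \<Longrightarrow> bet N (insert v X) = bet N {v} + bet N X"
  by (simp add: bet_def)

lemma dgr_empty [simp]: "dgr N {} = 0"
  by (simp add: dgr_def)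

lemma dgr_parity:
  "finite X \<Longrightarrow> even (dgr N X) = even (\<Sum>v\<in>X. dgr N {v})"
proof (induction X rule: finite_induct)
  case (insert v X)
  from dgr_insert[OF insert.hyps, of N]
  have "even (dgr N (insert v X)) = even (dgr N X + dgr N {v})"
    by presburger
  then show ?case using insert by auto
qed simp

lemma dgr_nV: "wf_net N \<Longrightarrow> dgr N (nV N) = tipdeg N"
  by (simp add: dgr_def tipdeg_def wf_net_def)

text \<open>Away from the tip, \<open>{v}\<close> and its complement cut the same edges, so the two
  degrees differ only in their tip edges.\<close>

lemma dgr_remove:
  assumes "wf_net N" "v \<in> nV N" "\<forall>e\<in>nE N. head N e = v \<longrightarrow> tail N e = v"
  shows "dgr N (nV N - {v}) + 2 * (pin N v + pout N v) = tipdeg N + dgr N {v}"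
proof -
  have "(\<Sum>e\<in>nE N. of_bool ((tail N e \<in> nV N - {v}) \<noteq> (head N e \<in> nV N - {v})) :: nat)
     = (\<Sum>e\<in>nE N. of_bool ((tail N e \<in> {v}) \<noteq> (head N e \<in> {v})))"
    using assms by (intro sum.cong) (auto simp: wf_net_def)
  moreover have "(\<Sum>v\<in>nV N. pin N v + pout N v) = (pin N v + pout N v) + (\<Sum>v\<in>nV N - {v}. pin N v + pout N v)"
    using assms by (intro sum.remove) (auto simp: wf_net_def)
  ultimately show ?thesis by (simp add: dgr_def tipdeg_def)
qed

lemma sum_inc:
  assumes "finite A"
  shows "(\<Sum>v\<in>A. inc N e v) = of_bool (tail N e \<in> A) - of_bool (head N e \<in> A)"
proof -
  have "(\<Sum>v\<in>A. of_bool (w = v) :: int) = of_bool (w \<in> A)" for w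
    using assms by (auto simp: of_bool_def sum.delta')
  then show ?thesis by (simp add: inc_def sum_subtractf)
qed

lemma sum_boundary:
  assumes "finite A"
  shows "(\<Sum>v\<in>A. \<Sum>e\<in>F. f e * inc N e v) = (\<Sum>e\<in>F. f e * (of_bool (tail N e \<in> A) - of_bool (head N e \<in> A)))"
  by (subst sum.swap) (simp add: sum_distrib_left[symmetric] sum_inc[OF assms])

section \<open>Contracting a vertex set\<close>

definition contract :: "('v, 'e) net \<Rightarrow> 'v set \<Rightarrow> 'v \<Rightarrow> ('v, 'e) net" where
  "contract N A a = \<lparr>nV = insert a (nV N - A), nE = nE N,
     tail = (\<lambda>e. if tail N e \<in> A then a else tail N e), head = (\<lambda>e. if head N e \<in> A then a else head N e),
     pin = (\<lambda>v. if v = a then \<Sum>u\<in>A. pin N u else pin N v),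
     pout = (\<lambda>v. if v = a then \<Sum>u\<in>A. pout N u else pout N v),
     bd = (\<lambda>v. if v = a then \<Sum>u\<in>A. bd N u else bd N v)\<rparr>"

definition uncontract :: "'v set \<Rightarrow> 'v \<Rightarrow> 'v set \<Rightarrow> 'v set" where
  "uncontract A a X = (if a \<in> X then X \<union> A else X)"

lemma sum_uncontract:
  fixes g :: "'v \<Rightarrow> 'a::comm_monoid_add"
  assumes "finite V" "A \<subseteq> V" "a \<in> A" "X \<subseteq> insert a (V - A)"
  shows "(\<Sum>v\<in>X. if v = a then \<Sum>u\<in>A. g u else g v) = (\<Sum>v\<in>uncontract A a X. g v)"
proof (cases "a \<in> X")
  case True
  have fin: "finite X" "finite A" using assms by (auto intro: finite_subset)
  have "(\<Sum>v\<in>X. if v = a then \<Sum>u\<in>A. g u else g v) = (\<Sum>u\<in>A. g u) + (\<Sum>v\<in>X - {a}. g v)"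
    using fin True by (subst sum.remove[of _ a]) (auto intro!: sum.cong)
  also have "\<dots> = (\<Sum>v\<in>A \<union> (X - {a}). g v)"
    using fin assms by (intro sum.union_disjoint[symmetric]) auto
  also have "A \<union> (X - {a}) = X \<union> A" using assms True by auto
  finally show ?thesis using True by (simp add: uncontract_def)
next
  case False
  then show ?thesis by (auto simp: uncontract_def intro!: sum.cong)
qed

text \<open>The cuts of the contraction are the cuts of \<open>N\<close> that do not separate
  \<open>A\<close>, and \<open>uncontract\<close> translates between them.\<close>

lemma contract_props:
  assumes "wf_net N" "A \<subseteq> nV N" "a \<in> A"
  shows "wf_net (contract N A a)"
    and "tipdeg (contract N A a) = tipdeg N"
    and "X \<subseteq> nV (contract N A a) \<Longrightarrow> dgr (contract N A a) X = dgr N (uncontract A a X)"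
    and "X \<subseteq> nV (contract N A a) \<Longrightarrow> bet (contract N A a) X = bet N (uncontract A a X)"
proof -
  let ?C = "contract N A a"
  have fin: "finite (nV N)" "finite A" using assms by (auto simp: wf_net_def intro: finite_subset)
  have V: "nV ?C = insert a (nV N - A)" by (simp add: contract_def)
  have u: "uncontract A a (nV ?C) = nV N" using assms by (auto simp: V uncontract_def)
  have *: "(\<Sum>v\<in>X. bd ?C v) = (\<Sum>v\<in>uncontract A a X. bd N v)"
      "(\<Sum>v\<in>X. pin ?C v) = (\<Sum>v\<in>uncontract A a X. pin N v)"
      "(\<Sum>v\<in>X. pout ?C v) = (\<Sum>v\<in>uncontract A a X. pout N v)" if "X \<subseteq> nV ?C" for X
    using sum_uncontract[OF fin(1) assms(2,3) that[unfolded V]] by (simp_all add: contract_def)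
  show "wf_net ?C"
    using assms *(1)[of "nV ?C"] fin unfolding wf_net_def u by (auto simp: contract_def)
  show "tipdeg ?C = tipdeg N"
    using *(2,3)[of "nV ?C"] by (simp add: tipdeg_def sum.distrib u)
  assume X: "X \<subseteq> nV ?C"
  have eq: "(tail ?C e \<in> X) = (tail N e \<in> uncontract A a X)" "(head ?C e \<in> X) = (head N e \<in> uncontract A a X)"
    if "e \<in> nE N" for e
    using X assms(2,3) unfolding V by (auto simp: contract_def uncontract_def)
  show "dgr ?C X = dgr N (uncontract A a X)"
    using *(2,3)[OF X] eq by (simp add: dgr_def sum.distrib) (simp add: contract_def)
  have "bet ?C X = (\<Sum>v\<in>X. bd ?C v) - int (\<Sum>v\<in>X. pin ?C v) + int (\<Sum>v\<in>X. pout ?C v)"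
    by (simp add: bet_def sum.distrib sum_subtractf)
  also have "\<dots> = bet N (uncontract A a X)"
    unfolding *[OF X] by (simp add: bet_def sum.distrib sum_subtractf)
  finally show "bet ?C X = bet N (uncontract A a X)" .
qed

text \<open>Anchors move to the vertices that represent them. If both twin anchors lie in
  \<open>A\<close>, they merge into one ordinary anchor, since sets containing both have degree at
  least \<open>6 = 7 - 1\<close>.\<close>

lemma contract_admissible:
  assumes "admissible N" "A \<subseteq> nV N" "a \<in> A"
  shows "admissible (contract N A a)"
proof -
  let ?C = "contract N A a"
  have wf: "wf_net N" using assms by (simp add: admissible_def)
  note props = contract_props[OF wf assms(2,3)]
  have V: "nV ?C = insert a (nV N - A)" by (simp add: contract_def)
  have sub: "uncontract A a X \<subseteq> nV N" if "X \<subseteq> nV ?C" for X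
    using that assms by (auto simp: V uncontract_def)
  have "good ?C"
    unfolding good_def
  proof (intro allI impI)
    fix X assume X: "X \<subseteq> nV ?C" "X \<noteq> {} \<and> X \<noteq> nV ?C"
    then have "uncontract A a X \<noteq> {}" "uncontract A a X \<noteq> nV N"
      using assms by (auto simp: V uncontract_def)
    then show "fine (dgr ?C X) (bet ?C X)"
      using sub[OF X(1)] X(1) assms props by (simp add: admissible_def good_def)
  qed
  moreover have "anchored ?C (nV ?C) (tipdeg ?C) \<or> twin_anchored ?C (nV ?C) (tipdeg ?C)"
  proof -
    define r where "r v = (if v \<in> A then a else v)" for v
    have rV: "r v \<in> nV ?C" if "v \<in> nV N" for v using that by (auto simp: r_def V)
    have ru: "v \<in> uncontract A a X" if "r v \<in> X" "v \<in> nV N" for v X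
      using that by (auto simp: r_def uncontract_def split: if_splits)
    consider "anchored N (nV N) (tipdeg N)" | "twin_anchored N (nV N) (tipdeg N)"
      using assms by (auto simp: admissible_def)
    then show ?thesis
    proof cases
      case 1
      then obtain x where x: "x \<in> nV N" "\<forall>X\<subseteq>nV N. x \<in> X \<longrightarrow> tipdeg N \<le> dgr N X + 1"
        by (auto simp: anchored_def)
      have "\<forall>X\<subseteq>nV ?C. r x \<in> X \<longrightarrow> tipdeg ?C \<le> dgr ?C X + 1"
        using x sub ru props by auto
      then show ?thesis using rV[OF x(1)] by (auto simp: anchored_def)
    next
      case 2
      then obtain x y where xy: "x \<in> nV N" "y \<in> nV N" "x \<noteq> y" "tipdeg N = 7"
        "\<forall>X\<subseteq>nV N. (x \<in> X \<or> y \<in> X \<longrightarrow> 5 \<le> dgr N X) \<and> (x \<in> X \<and> y \<in> X \<longrightarrow> 6 \<le> dgr N X)"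
        by (auto simp: twin_anchored_def)
      show ?thesis
      proof (cases "r x = r y")
        case True
        have "\<forall>X\<subseteq>nV ?C. r x \<in> X \<longrightarrow> tipdeg ?C \<le> dgr ?C X + 1"
        proof (intro allI impI)
          fix X assume X: "X \<subseteq> nV ?C" "r x \<in> X"
          then have "x \<in> uncontract A a X" "y \<in> uncontract A a X"
            using True xy ru by auto
          then have "6 \<le> dgr N (uncontract A a X)" using xy sub[OF X(1)] by blast
          then show "tipdeg ?C \<le> dgr ?C X + 1" using props xy X by simp
        qed
        then show ?thesis using rV[OF xy(1)] by (auto simp: anchored_def)
      next
        case False
        have "\<forall>X\<subseteq>nV ?C. (r x \<in> X \<or> r y \<in> X \<longrightarrow> 5 \<le> dgr ?C X) \<and> (r x \<in> X \<and> r y \<in> X \<longrightarrow> 6 \<le> dgr ?C X)"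
          using xy sub ru props by auto
        then show ?thesis
          using rV[OF xy(1)] rV[OF xy(2)] False props(2) xy(4) unfolding twin_anchored_def by metis
      qed
    qed
  qed
  ultimately show ?thesis using props by (simp add: admissible_def)
qed

text \<open>Inside \<open>A\<close> only the total excess is controlled: the excesses of all
  vertices add up to 0 modulo 3, and those outside \<open>A\<close> vanish.\<close>

lemma contract_flow:
  assumes "wf_net N" "A \<subseteq> nV N" "a \<in> A" "flow (contract N A a) f"
  shows "\<forall>e\<in>nE N. f e = 1 \<or> f e = -1"
    and "v \<in> nV N - A \<Longrightarrow> 3 dvd (\<Sum>e\<in>nE N. f e * inc N e v) - bd N v"
    and "3 dvd (\<Sum>v\<in>A. (\<Sum>e\<in>nE N. f e * inc N e v) - bd N v)"
proof -
  let ?C = "contract N A a"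
  let ?g = "\<lambda>v. (\<Sum>e\<in>nE N. f e * inc N e v) - bd N v"
  have fin: "finite (nV N)" "finite A" using assms by (auto simp: wf_net_def intro: finite_subset)
  show "\<forall>e\<in>nE N. f e = 1 \<or> f e = -1" using assms by (auto simp: flow_def contract_def)
  have out: "3 dvd ?g v" if "v \<in> nV N - A" for v
  proof -
    have v: "v \<noteq> a" "v \<notin> A" using that assms by auto
    have "inc ?C e v = inc N e v" for e
      using v by (auto simp: inc_def contract_def)
    moreover have "bd ?C v = bd N v" "v \<in> nV ?C" "nE ?C = nE N" using that v by (auto simp: contract_def)
    ultimately show ?thesis using assms(4) unfolding flow_def by (metis (no_types, lifting) sum.cong)
  qed
  then show "v \<in> nV N - A \<Longrightarrow> 3 dvd ?g v" .
  have "(\<Sum>v\<in>nV N. \<Sum>e\<in>nE N. f e * inc N e v) = 0"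
    using assms by (subst sum_boundary[OF fin(1)]) (auto simp: wf_net_def)
  then have "3 dvd (\<Sum>v\<in>nV N. ?g v)"
    using assms(1) by (simp add: sum_subtractf wf_net_def)
  moreover have "3 dvd (\<Sum>v\<in>nV N - A. ?g v)" using out by (intro dvd_sum) auto
  moreover have "(\<Sum>v\<in>nV N. ?g v) = (\<Sum>v\<in>nV N - A. ?g v) + (\<Sum>v\<in>A. ?g v)"
    using assms fin by (intro sum.subset_diff) auto
  ultimately show "3 dvd (\<Sum>v\<in>A. ?g v)" by (simp add: dvd_add_right_iff)
qed

subsection \<open>Restriction and minimal counterexamples\<close>

text \<open>The possible sums 2, 0 and -2 represent all residues modulo 3.\<close>

lemma two_signs:
  obtains s1 s2 :: int where "s1 = 1 \<or> s1 = -1" "s2 = 1 \<or> s2 = -1" "3 dvd s1 + s2 - r"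
proof -
  have "3 dvd 1 + 1 - r \<or> 3 dvd 1 + (-1) - r \<or> 3 dvd (-1) + (-1) - r" by presburger
  then show ?thesis using that by metis
qed

definition inner_edges :: "('v, 'e) net \<Rightarrow> 'v set \<Rightarrow> 'e set" where
  "inner_edges N A = {e \<in> nE N. tail N e \<in> A \<and> head N e \<in> A}"

text \<open>A cut edge of \<open>A\<close>, oriented by \<open>f\<close>, becomes a tip edge at its
  end in \<open>A\<close>. Edges that avoid \<open>A\<close> have \<open>inc\<close> zero on
  \<open>A\<close> and simply disappear.\<close>

definition restrict_net :: "('v, 'e) net \<Rightarrow> 'v set \<Rightarrow> ('e \<Rightarrow> int) \<Rightarrow> ('v, 'e) net" where
  "restrict_net N A f = N\<lparr>nV := A, nE := inner_edges N A,
     pin := (\<lambda>v. pin N v + (\<Sum>e\<in>nE N - inner_edges N A. of_bool (f e * inc N e v = -1))),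
     pout := (\<lambda>v. pout N v + (\<Sum>e\<in>nE N - inner_edges N A. of_bool (f e * inc N e v = 1))),
     bd := (\<lambda>v. bd N v - (\<Sum>e\<in>nE N - inner_edges N A. f e * inc N e v))\<rparr>"

text \<open>An edge from \<open>X\<close> to the outside of \<open>A\<close> is now counted as a tip
  edge instead, and its share in \<open>bd\<close> cancels against its share in \<open>pin\<close>
  or \<open>pout\<close>.\<close>

lemma restrict_net_props:
  assumes wf: "wf_net N" and A: "A \<subseteq> nV N" and f: "\<forall>e\<in>nE N. f e = 1 \<or> f e = -1"
    and X: "X \<subseteq> A"
  shows "dgr (restrict_net N A f) X = dgr N X" "bet (restrict_net N A f) X = bet N X"
proof -
  let ?R = "restrict_net N A f" and ?O = "nE N - inner_edges N A"
  have fin: "finite (nE N)" "finite X" "finite (inner_edges N A)"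
    using wf A X by (auto simp: wf_net_def inner_edges_def intro: finite_subset)
  have fi: "(f e * inc N e v = -1 \<or> f e * inc N e v = 1) \<longleftrightarrow> tail N e = v \<or> head N e = v"
    if "e \<in> ?O" "v \<in> X" for e v
    using that X f by (auto simp: inc_def inner_edges_def)
  have one: "(\<Sum>v\<in>X. of_bool (f e * inc N e v = -1) + of_bool (f e * inc N e v = 1))
      = (of_bool ((tail N e \<in> X) \<noteq> (head N e \<in> X)) :: nat)" if e: "e \<in> ?O" for e
  proof -
    have "(\<Sum>v\<in>X. of_bool (f e * inc N e v = -1) + of_bool (f e * inc N e v = 1) :: nat)
      = (\<Sum>v\<in>X. of_bool (tail N e = v) + of_bool (head N e = v))"
      using fi[OF e] f e X by (intro sum.cong) (auto simp: inc_def inner_edges_def)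
    also have "\<dots> = of_bool (tail N e \<in> X) + of_bool (head N e \<in> X)"
      using fin by (simp add: sum.distrib of_bool_def sum.delta')
    finally show ?thesis using e X by (auto simp: inner_edges_def)
  qed
  have split: "(\<Sum>e\<in>nE N. g e) = (\<Sum>e\<in>inner_edges N A. g e) + (\<Sum>e\<in>?O. g e)" for g :: "'b \<Rightarrow> nat"
    using sum.subset_diff[of "inner_edges N A" "nE N" g] fin by (auto simp: inner_edges_def)
  have "(\<Sum>v\<in>X. pin ?R v + pout ?R v) = (\<Sum>v\<in>X. pin N v + pout N v)
     + (\<Sum>v\<in>X. \<Sum>e\<in>?O. of_bool (f e * inc N e v = -1) + of_bool (f e * inc N e v = 1))"
    by (simp add: restrict_net_def sum.distrib)
  also have "\<dots> = (\<Sum>v\<in>X. pin N v + pout N v) + (\<Sum>e\<in>?O. of_bool ((tail N e \<in> X) \<noteq> (head N e \<in> X)))"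
    using one by (subst sum.swap) simp
  finally show "dgr ?R X = dgr N X"
    by (simp add: dgr_def split restrict_net_def)
  have "bd ?R v - int (pin ?R v) + int (pout ?R v) = bd N v - int (pin N v) + int (pout N v)"
    if v: "v \<in> X" for v
  proof -
    have "(\<Sum>e\<in>?O. f e * inc N e v) = (\<Sum>e\<in>?O. of_bool (f e * inc N e v = 1) - of_bool (f e * inc N e v = -1))"
      using f by (intro sum.cong) (auto simp: inc_def)
    also have "\<dots> = (\<Sum>e\<in>?O. of_bool (f e * inc N e v = 1)) - (\<Sum>e\<in>?O. of_bool (f e * inc N e v = -1))"
      by (rule sum_subtractf)
    finally show ?thesis by (simp add: restrict_net_def)
  qed
  then show "bet ?R X = bet N X" by (simp add: bet_def)
qed

text \<open>The tip degree of the restriction is \<open>dgr N A\<close>, which explains the form of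
  \<open>anch\<close>; \<open>bal\<close> provides the zero total boundary. The size drops because
  an edge that is not inside \<open>A\<close> weighs 2 and yields at most one new tip edge.\<close>

lemma restrict_net_admissible:
  assumes wf: "wf_net N" and gd: "good N" and A: "A \<subseteq> nV N" "A \<noteq> nV N"
    and f: "\<forall>e\<in>nE N. f e = 1 \<or> f e = -1"
    and bal: "3 dvd (\<Sum>v\<in>A. (\<Sum>e\<in>nE N. f e * inc N e v) - bd N v)"
    and anch: "anchored N A (dgr N A) \<or> twin_anchored N A (dgr N A)"
  shows "admissible (restrict_net N A f)" "net_size (restrict_net N A f) < net_size N"
proof -
  let ?R = "restrict_net N A f" and ?O = "nE N - inner_edges N A"
  have fin: "finite (nV N)" "finite (nE N)" "finite A" "finite (inner_edges N A)"
    using wf A by (auto simp: wf_net_def inner_edges_def intro: finite_subset)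
  note props = restrict_net_props[OF wf A(1) f]
  have sel: "nV ?R = A" "nE ?R = inner_edges N A" "tail ?R = tail N" "head ?R = head N"
    by (simp_all add: restrict_net_def)
  have "(\<Sum>v\<in>A. \<Sum>e\<in>nE N. f e * inc N e v) = (\<Sum>v\<in>A. \<Sum>e\<in>?O. f e * inc N e v)"
    unfolding sum_boundary[OF fin(3)]
    using fin by (intro sum.mono_neutral_right) (auto simp: inner_edges_def)
  then have "(\<Sum>v\<in>A. bd ?R v) = - (\<Sum>v\<in>A. (\<Sum>e\<in>nE N. f e * inc N e v) - bd N v)"
    by (simp add: restrict_net_def sum_subtractf)
  then have wfR: "wf_net ?R"
    unfolding wf_net_def sel using bal fin by (auto simp: inner_edges_def)
  have tip: "tipdeg ?R = dgr N A" using dgr_nV[OF wfR] props[of A] sel by simp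
  have "good ?R" unfolding good_def sel
  proof (intro allI impI)
    fix X assume "X \<subseteq> A" "X \<noteq> {} \<and> X \<noteq> A"
    then show "fine (dgr ?R X) (bet ?R X)" using gd A props[of X] by (auto simp: good_def)
  qed
  moreover have "anchored ?R A (dgr N A) \<or> twin_anchored ?R A (dgr N A)"
    using anch props unfolding anchored_def twin_anchored_def by (metis (no_types, lifting))
  ultimately show "admissible ?R" using wfR tip sel by (simp add: admissible_def)
  have "(\<Sum>e\<in>nE N. of_bool ((tail N e \<in> A) \<noteq> (head N e \<in> A)) :: nat) \<le> (\<Sum>e\<in>?O. 1)"
  proof -
    have "(\<Sum>e\<in>nE N. of_bool ((tail N e \<in> A) \<noteq> (head N e \<in> A)) :: nat)
      = (\<Sum>e\<in>?O. of_bool ((tail N e \<in> A) \<noteq> (head N e \<in> A)))"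
      using fin by (intro sum.mono_neutral_right) (auto simp: inner_edges_def)
    also have "\<dots> \<le> (\<Sum>e\<in>?O. 1)" by (intro sum_mono) auto
    finally show ?thesis .
  qed
  moreover have "(\<Sum>v\<in>A. pin N v + pout N v) \<le> tipdeg N"
    unfolding tipdeg_def using A fin by (intro sum_mono2) auto
  moreover have "card ?O + card (inner_edges N A) = card (nE N)"
  proof -
    have "card (inner_edges N A) \<le> card (nE N)" using fin by (intro card_mono) (auto simp: inner_edges_def)
    then show ?thesis using fin by (subst card_Diff_subset) (auto simp: inner_edges_def)
  qed
  moreover have "card A < card (nV N)" using A fin by (intro psubset_card_mono) auto
  ultimately show "net_size ?R < net_size N"
    unfolding net_size_def tip sel by (simp add: dgr_def)
qed

text \<open>The boundary of the restriction was lowered by exactly what the fixed edges contribute,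
  so inner edges can follow \<open>g\<close> while all others keep \<open>f\<close>.\<close>

lemma restrict_net_flow:
  assumes wf: "wf_net N" and A: "A \<subseteq> nV N" and f: "\<forall>e\<in>nE N. f e = 1 \<or> f e = -1"
    and out: "\<And>v. v \<in> nV N - A \<Longrightarrow> 3 dvd (\<Sum>e\<in>nE N. f e * inc N e v) - bd N v"
    and g: "flow (restrict_net N A f) g"
  shows "flow N (\<lambda>e. if e \<in> inner_edges N A then g e else f e)"
proof -
  let ?R = "restrict_net N A f" and ?O = "nE N - inner_edges N A"
  let ?h = "\<lambda>e. if e \<in> inner_edges N A then g e else f e"
  have fin: "finite (nE N)" "finite (inner_edges N A)"
    using wf by (auto simp: wf_net_def inner_edges_def)
  have split: "(\<Sum>e\<in>nE N. h e) = (\<Sum>e\<in>?O. h e) + (\<Sum>e\<in>inner_edges N A. h e)" for h :: "'b \<Rightarrow> int"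
    using fin by (intro sum.subset_diff) (auto simp: inner_edges_def)
  have hs: "(\<Sum>e\<in>nE N. ?h e * inc N e v) = (\<Sum>e\<in>?O. f e * inc N e v) + (\<Sum>e\<in>inner_edges N A. g e * inc N e v)" for v
    by (simp add: split)
  have "3 dvd (\<Sum>e\<in>nE N. ?h e * inc N e v) - bd N v" if v: "v \<in> nV N" for v
  proof (cases "v \<in> A")
    case True
    have "3 dvd (\<Sum>e\<in>inner_edges N A. g e * inc ?R e v) - bd ?R v"
      using g True by (auto simp: flow_def restrict_net_def)
    moreover have "inc ?R e v = inc N e v" for e by (simp add: inc_def restrict_net_def)
    ultimately show ?thesis unfolding hs by (simp add: restrict_net_def algebra_simps)
  next
    case False
    have z: "(\<Sum>e\<in>inner_edges N A. h e * inc N e v) = 0" for h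
      using False by (intro sum.neutral) (auto simp: inner_edges_def inc_def)
    show ?thesis unfolding hs using out[of v] v False by (simp add: split z)
  qed
  then show ?thesis using g f by (auto simp: flow_def restrict_net_def)
qed

lemma flow_single_vertex:
  assumes "wf_net N" "nV N = {v}"
  shows "flow N (\<lambda>_. 1)"
proof -
  have "(\<Sum>e\<in>nE N. 1 * inc N e v) = 0"
    using assms by (intro sum.neutral) (auto simp: wf_net_def inc_def)
  then show ?thesis using assms by (auto simp: flow_def wf_net_def)
qed

section \<open>Minimal counterexamples\<close>

locale minimal_net =
  fixes N :: "('v, 'e) net"
  assumes adm: "admissible N"
    and noflow: "\<not> flow N f"
    and smaller: "\<And>M :: ('v, 'e) net. admissible M \<Longrightarrow> net_size M < net_size N \<Longrightarrow> \<exists>f. flow M f"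
begin

lemma wf: "wf_net N" and gd: "good N"
  and anch: "anchored N (nV N) (tipdeg N) \<or> twin_anchored N (nV N) (tipdeg N)"
  using adm by (auto simp: admissible_def)

lemma finV [simp]: "finite (nV N)" and finE [simp]: "finite (nE N)"
  and ends_in: "e \<in> nE N \<Longrightarrow> tail N e \<in> nV N" "e \<in> nE N \<Longrightarrow> head N e \<in> nV N"
  using wf by (auto simp: wf_net_def)

lemma finX: "X \<subseteq> nV N \<Longrightarrow> finite X"
  using finV finite_subset by blast

lemma fineX: "X \<subseteq> nV N \<Longrightarrow> X \<noteq> {} \<Longrightarrow> X \<noteq> nV N \<Longrightarrow> fine (dgr N X) (bet N X)"
  using gd by (auto simp: good_def)

lemma dgr4: "X \<subseteq> nV N \<Longrightarrow> X \<noteq> {} \<Longrightarrow> X \<noteq> nV N \<Longrightarrow> 4 \<le> dgr N X"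
  using fineX by (auto simp: fine_def)

lemma not_single: "nV N \<noteq> {v}"
  using flow_single_vertex[OF wf] noflow by auto

lemma nV_nonempty: "nV N \<noteq> {}"
  using anch by (auto simp: anchored_def twin_anchored_def)

lemma obtain_other:
  obtains w where "w \<in> nV N" "w \<noteq> v"
  using not_single[of v] nV_nonempty by blast

lemma fine_single: "v \<in> nV N \<Longrightarrow> fine (dgr N {v}) (bet N {v})"
  using not_single by (intro fineX) auto

lemma contract_obtains_flow:
  assumes "A \<subseteq> nV N" "2 \<le> card A" "a \<in> A"
  obtains f where "flow (contract N A a) f"
proof -
  have fin: "finite A" using assms(1) by (rule finX)
  have "nV (contract N A a) = insert a (nV N - A)" by (simp add: contract_def)
  moreover have "card (insert a (nV N - A)) = Suc (card (nV N) - card A)"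
    using assms fin by (simp add: card_Diff_subset)
  moreover have "card A \<le> card (nV N)" using assms by (simp add: card_mono)
  ultimately have "net_size (contract N A a) < net_size N"
    using assms contract_props(2)[OF wf assms(1,3)] by (simp add: net_size_def contract_def)
  then show ?thesis using smaller contract_admissible[OF adm assms(1,3)] that by blast
qed

text \<open>Minimality gives a flow after contraction of \<open>A\<close>, and it orients the cut
  edges of \<open>A\<close>. If \<open>A\<close> were anchored for its own degree, the restriction
  to \<open>A\<close> would have a flow too, and the two would fit together. The lower bounds on
  larger cuts rest on this.\<close>

lemma not_anchored:
  assumes "A \<subset> nV N" "2 \<le> card A"
  shows "\<not> anchored N A (dgr N A)" "\<not> twin_anchored N A (dgr N A)"
proof -
  obtain a where a: "a \<in> A" using assms by fastforce
  have A: "A \<subseteq> nV N" "A \<noteq> nV N" using assms by auto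
  obtain f where f: "flow (contract N A a) f" using contract_obtains_flow[OF A(1) assms(2) a] .
  note cf = contract_flow[OF wf A(1) a f]
  have "\<not> (anchored N A (dgr N A) \<or> twin_anchored N A (dgr N A))"
  proof
    assume *: "anchored N A (dgr N A) \<or> twin_anchored N A (dgr N A)"
    obtain g where "flow (restrict_net N A f) g"
      using smaller restrict_net_admissible[OF wf gd A cf(1,3) *] by blast
    then show False using restrict_net_flow[OF wf A(1) cf(1,2)] noflow by blast
  qed
  then show "\<not> anchored N A (dgr N A)" "\<not> twin_anchored N A (dgr N A)" by auto
qed

text \<open>Contract \<open>u\<close> and \<open>v\<close>. Both edges become loops, so their signs
  are free and can be chosen to balance \<open>u\<close>; then \<open>v\<close> is balanced too,
  because the total excess of \<open>{u, v}\<close> is zero.\<close>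

lemma no_parallel:
  assumes e: "e1 \<in> nE N" "e2 \<in> nE N" "e1 \<noteq> e2" and uv: "tail N e1 = u" "head N e1 = v" "u \<noteq> v"
    and par: "tail N e2 = u \<and> head N e2 = v \<or> tail N e2 = v \<and> head N e2 = u"
  shows False
proof -
  have A: "{u, v} \<subseteq> nV N" "2 \<le> card {u, v}" "u \<in> {u, v}" using e uv ends_in by auto
  obtain f where f: "flow (contract N {u, v} u) f" using contract_obtains_flow[OF A] .
  note cf = contract_flow[OF wf A(1,3) f]
  let ?g = "\<lambda>f w. (\<Sum>e\<in>nE N. f e * inc N e w) - bd N w"
  \<comment> \<open>What the two parallel edges together must supply at \<open>u\<close>.\<close>
  define r where "r = bd N u - (\<Sum>e\<in>nE N - {e1, e2}. f e * inc N e u)"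
  obtain s1 s2 :: int where s: "s1 = 1 \<or> s1 = -1" "s2 = 1 \<or> s2 = -1" "3 dvd s1 + s2 - r"
    by (rule two_signs)
  \<comment> \<open>The factor \<open>inc N e2 u\<close> makes the contribution of \<open>e2\<close>
    at \<open>u\<close> equal to \<open>s2\<close>, whichever way \<open>e2\<close> is
    directed.\<close>
  define h where "h = f(e1 := s1, e2 := s2 * inc N e2 u)"
  have i: "inc N e1 u = 1" "inc N e1 v = -1" "inc N e2 u = 1 \<or> inc N e2 u = -1" "inc N e2 v = - inc N e2 u"
    using uv par by (auto simp: inc_def)
  have split: "(\<Sum>e\<in>nE N. k e) = k e1 + k e2 + (\<Sum>e\<in>nE N - {e1, e2}. k e)" for k :: "'e \<Rightarrow> int"
  proof -
    have "(\<Sum>e\<in>nE N. k e) = (\<Sum>e\<in>nE N - {e1, e2}. k e) + (\<Sum>e\<in>{e1, e2}. k e)"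
      using e by (intro sum.subset_diff) auto
    then show ?thesis using e by simp
  qed
  have rest: "(\<Sum>e\<in>nE N - {e1, e2}. h e * inc N e w) = (\<Sum>e\<in>nE N - {e1, e2}. f e * inc N e w)" for w
    by (intro sum.cong) (auto simp: h_def)
  have hu: "3 dvd ?g h u"
    using s(3) i e unfolding split rest r_def by (auto simp: h_def algebra_simps)
  have "?g h u + ?g h v = ?g f u + ?g f v"
    unfolding split rest using i e by (auto simp: h_def)
  moreover have "3 dvd ?g f u + ?g f v" using cf(3) uv by simp
  ultimately have hv: "3 dvd ?g h v" using hu by presburger
  have "3 dvd ?g h w" if "w \<in> nV N" for w
  proof (cases "w \<in> {u, v}")
    case False
    then have "inc N e1 w = 0" "inc N e2 w = 0" using uv par by (auto simp: inc_def)
    then have "?g h w = ?g f w" unfolding split rest by simp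
    then show ?thesis using cf(2)[of w] that False by simp
  qed (use hu hv in auto)
  moreover have "\<forall>e\<in>nE N. h e = 1 \<or> h e = -1" using cf(1) s i by (auto simp: h_def)
  ultimately show False using noflow[of h] by (auto simp: flow_def)
qed

end

section \<open>Symmetries: reversal of all orientations and change of reference directions\<close>

lemma fine_uminus [simp]: "fine d (- s) = fine d s"
  by (simp add: fine_def)

lemma fine_add: "3 dvd r \<Longrightarrow> fine d (r + s) = fine d s"
  by (simp add: fine_def dvd_add_right_iff)

lemma admissible_transfer:
  assumes "admissible N" "wf_net M" "nV M = nV N" "\<And>X. dgr M X = dgr N X"
    "\<And>X. bet M X = bet N X \<or> bet M X = - bet N X"
  shows "admissible M"
proof -
  have "tipdeg M = tipdeg N"
    using assms dgr_nV[of M] dgr_nV[of N] by (simp add: admissible_def)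
  moreover have "good M"
    unfolding good_def assms(3,4)
  proof (intro allI impI)
    fix X assume "X \<subseteq> nV N" "X \<noteq> {} \<and> X \<noteq> nV N"
    then have "fine (dgr N X) (bet N X)" using assms(1) by (simp add: admissible_def good_def)
    then show "fine (dgr N X) (bet M X)" using assms(5)[of X] by auto
  qed
  ultimately show ?thesis
    using assms(1-4) unfolding admissible_def anchored_def twin_anchored_def by simp
qed

definition mirror :: "('v, 'e) net \<Rightarrow> ('v, 'e) net" where
  "mirror N = N\<lparr>pin := pout N, pout := pin N, bd := (\<lambda>v. - bd N v)\<rparr>"

text \<open>Only reference directions change: \<open>v\<close> becomes the tail of every edge at
  \<open>v\<close>. A flow has to change sign on the flipped edges.\<close>

definition orient_out :: "('v, 'e) net \<Rightarrow> 'v \<Rightarrow> ('v, 'e) net" where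
  "orient_out N v = N\<lparr>tail := (\<lambda>e. if head N e = v then v else tail N e),
     head := (\<lambda>e. if head N e = v then tail N e else head N e)\<rparr>"

lemma dgr_mirror: "dgr (mirror N) X = dgr N X"
  by (simp add: dgr_def mirror_def add.commute)

lemma bet_mirror: "bet (mirror N) X = - bet N X"
  by (simp add: bet_def mirror_def sum_negf[symmetric] algebra_simps)

lemma dgr_orient_out: "dgr (orient_out N v) X = dgr N X"
proof -
  have "(\<Sum>e\<in>nE N. of_bool ((tail (orient_out N v) e \<in> X) \<noteq> (head (orient_out N v) e \<in> X)) :: nat)
     = (\<Sum>e\<in>nE N. of_bool ((tail N e \<in> X) \<noteq> (head N e \<in> X)))"
    by (intro sum.cong) (auto simp: orient_out_def)
  then show ?thesis by (simp add: dgr_def) (simp add: orient_out_def)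
qed

lemma bet_orient_out: "bet (orient_out N v) X = bet N X"
  by (simp add: bet_def orient_out_def)

context minimal_net
begin

lemma minimal_mirror: "minimal_net (mirror N)"
proof
  have "wf_net (mirror N)" using wf by (simp add: wf_net_def mirror_def sum_negf)
  then show "admissible (mirror N)"
    by (rule admissible_transfer[OF adm]) (simp_all add: dgr_mirror bet_mirror, simp add: mirror_def)
next
  fix f
  show "\<not> flow (mirror N) f"
  proof
    assume f: "flow (mirror N) f"
    have "3 dvd (\<Sum>e\<in>nE N. - f e * inc N e v) - bd N v" if "v \<in> nV N" for v
    proof -
      have "3 dvd (\<Sum>e\<in>nE N. f e * inc N e v) - - bd N v"
        using f that by (simp add: flow_def mirror_def inc_def)
      then show ?thesis by (simp add: sum_negf) presburger
    qed
    then have "flow N (\<lambda>e. - f e)" using f by (auto simp: flow_def mirror_def)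
    then show False using noflow by blast
  qed
next
  fix M :: "('v, 'e) net" assume "admissible M" "net_size M < net_size (mirror N)"
  moreover have "net_size (mirror N) = net_size N"
    by (simp add: net_size_def mirror_def tipdeg_def add.commute)
  ultimately show "\<exists>f. flow M f" using smaller by simp
qed

lemma minimal_orient_out: "minimal_net (orient_out N v)"
proof
  have "wf_net (orient_out N v)" using wf by (auto simp: wf_net_def orient_out_def)
  then show "admissible (orient_out N v)"
    by (rule admissible_transfer[OF adm]) (simp_all add: dgr_orient_out bet_orient_out, simp add: orient_out_def)
next
  fix f
  show "\<not> flow (orient_out N v) f"
  proof
    assume f: "flow (orient_out N v) f"
    let ?g = "\<lambda>e. if head N e = v then - f e else f e"
    have "(\<Sum>e\<in>nE N. ?g e * inc N e w) = (\<Sum>e\<in>nE N. f e * inc (orient_out N v) e w)" for w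
      by (intro sum.cong) (auto simp: inc_def orient_out_def)
    then have "flow N ?g" using f by (auto simp: flow_def orient_out_def)
    then show False using noflow by blast
  qed
next
  fix M :: "('v, 'e) net" assume "admissible M" "net_size M < net_size (orient_out N v)"
  moreover have "net_size (orient_out N v) = net_size N"
    by (simp add: net_size_def orient_out_def tipdeg_def)
  ultimately show "\<exists>f. flow M f" using smaller by simp
qed

text \<open>In a set of degree at most 5 every vertex is an anchor, because all nonempty subsets
  have degree at least 4.\<close>

lemma dgr_ge_6:
  assumes "A \<subset> nV N" "2 \<le> card A"
  shows "6 \<le> dgr N A"
proof (rule ccontr)
  assume "\<not> 6 \<le> dgr N A"
  moreover obtain x where "x \<in> A" using assms by fastforce
  moreover have "4 \<le> dgr N X" if "X \<subseteq> A" "x \<in> X" for X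
    using that assms by (intro dgr4) auto
  ultimately have "x \<in> A" "dgr N A \<le> dgr N X + 1" if "X \<subseteq> A" "x \<in> X" for X
    using that by (auto simp: not_le less_Suc_eq_le intro: order_trans[of _ 5])
  then have "anchored N A (dgr N A)" using \<open>x \<in> A\<close> by (auto simp: anchored_def)
  then show False using not_anchored assms by blast
qed

lemma single_or_dgr_ge_6:
  assumes "A \<subset> nV N" "X \<subseteq> A" "x \<in> X"
  shows "X = {x} \<or> 2 \<le> card X \<and> 6 \<le> dgr N X"
proof (cases "X = {x}")
  case False
  have "finite X" using assms finX by blast
  then have "card {x} < card X" using assms False by (intro psubset_card_mono) auto
  then show ?thesis using dgr_ge_6[of X] assms by auto
qed simp

text \<open>A vertex of degree at least 5 would be an anchor of \<open>A\<close>, since subsets with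
  two or more vertices have degree at least 6 anyway.\<close>

lemma dgr_6_single:
  assumes "A \<subset> nV N" "2 \<le> card A" "dgr N A = 6" "v \<in> A"
  shows "dgr N {v} = 4"
proof (rule ccontr)
  assume "dgr N {v} \<noteq> 4"
  then have "5 \<le> dgr N {v}" using fine_single[of v] assms by (auto simp: fine_def)
  then have "dgr N A \<le> dgr N X + 1" if "X \<subseteq> A" "v \<in> X" for X
    using single_or_dgr_ge_6[OF assms(1) that] assms(3) by auto
  then show False using not_anchored(1)[OF assms(1,2)] assms(4) by (auto simp: anchored_def)
qed

text \<open>A vertex of degree at least 6 would be an anchor of \<open>A\<close>.\<close>

lemma dgr_7_single:
  assumes "A \<subset> nV N" "2 \<le> card A" "dgr N A = 7" "v \<in> A"
  shows "dgr N {v} \<le> 5"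
proof (rule ccontr)
  assume "\<not> dgr N {v} \<le> 5"
  then have "dgr N A \<le> dgr N X + 1" if "X \<subseteq> A" "v \<in> X" for X
    using single_or_dgr_ge_6[OF assms(1) that] assms(3) by auto
  then show False using not_anchored(1)[OF assms(1,2)] assms(4) by (auto simp: anchored_def)
qed

text \<open>Here the twin condition pays off: neither vertex need be an anchor of \<open>A\<close>,
  but together they are twin anchors.\<close>

lemma dgr_7_unique:
  assumes "A \<subset> nV N" "2 \<le> card A" "dgr N A = 7" "v \<in> A" "w \<in> A" "v \<noteq> w"
    "5 \<le> dgr N {v}" "5 \<le> dgr N {w}"
  shows False
proof -
  have "5 \<le> dgr N X" if "X \<subseteq> A" "v \<in> X \<or> w \<in> X" for X
    using single_or_dgr_ge_6[OF assms(1) that(1), of v] single_or_dgr_ge_6[OF assms(1) that(1), of w] that(2) assms(7,8) by auto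
  moreover have "6 \<le> dgr N X" if "X \<subseteq> A" "v \<in> X" "w \<in> X" for X
    using single_or_dgr_ge_6[OF assms(1) that(1,2)] that(3) assms(6) by auto
  ultimately have "twin_anchored N A (dgr N A)"
    using assms unfolding twin_anchored_def by blast
  then show False using not_anchored assms by blast
qed

lemma bet_sum: "finite A \<Longrightarrow> bet N A = (\<Sum>v\<in>A. bet N {v})"
  by (simp add: bet_def)

lemma bet_single_4: "v \<in> nV N \<Longrightarrow> dgr N {v} = 4 \<Longrightarrow> 3 dvd bet N {v}"
  using fine_single by (auto simp: fine_def)

text \<open>Lets a set lose two edges when a vertex is split off. A set of degree 6 has only
  vertices of degree 4, all with zero boundary. A set of degree 7 has, by parity, a vertex of degree
  other than 4; it is unique and has degree 5, and its nonzero boundary is that of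
  \<open>A\<close>.\<close>

lemma fine_lowered:
  assumes A: "A \<subset> nV N" "2 \<le> card A" and d: "dgr N A = d + 2"
  shows "fine d (bet N A)"
proof -
  have fin: "finite A" using A finX by blast
  have 6: "3 dvd bet N A" if "d = 4"
    unfolding bet_sum[OF fin]
    using dgr_6_single[OF A] d that A bet_single_4 by (intro dvd_sum) auto
  have 7: "\<not> 3 dvd bet N A" if "d = 5"
  proof
    assume dvd: "3 dvd bet N A"
    have A7: "dgr N A = 7" using d that by simp
    have "\<exists>u\<in>A. dgr N {u} \<noteq> 4"
    proof (rule ccontr)
      assume "\<not> ?thesis"
      then have "even (\<Sum>v\<in>A. dgr N {v})" by (intro dvd_sum) auto
      then show False using dgr_parity[OF fin, of N] A7 by simp
    qed
    then obtain u where u: "u \<in> A" "dgr N {u} \<noteq> 4" by blast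
    have ge: "4 \<le> dgr N {v}" if "v \<in> A" for v using that A fine_single[of v] by (auto simp: fine_def)
    have u5: "dgr N {u} = 5" using dgr_7_single[OF A A7 u(1)] ge[OF u(1)] u(2) by simp
    have "dgr N {v} = 4" if "v \<in> A - {u}" for v
      using dgr_7_unique[OF A A7, of v u] dgr_7_single[OF A A7, of v] ge[of v] that u u5 by force
    then have "3 dvd (\<Sum>v\<in>A - {u}. bet N {v})"
      using A bet_single_4 by (intro dvd_sum) auto
    moreover have "bet N A = bet N {u} + (\<Sum>v\<in>A - {u}. bet N {v})"
      unfolding bet_sum[OF fin] using fin u by (intro sum.remove)
    ultimately have "3 dvd bet N {u}" using dvd by (simp add: dvd_add_left_iff)
    then show False using fine_single[of u] A u u5 by (auto simp: fine_def)
  qed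
  show ?thesis using 6 7 dgr_ge_6[OF A] d by (simp add: fine_def)
qed

text \<open>Otherwise the anchor \<open>x\<close> of the whole net would also be an anchor of
  \<open>A\<close>. The bound improves on the assumption by 2, which pays for edges lost in later
  reductions.\<close>

lemma dgr_anchor_gt:
  assumes "\<forall>X\<subseteq>nV N. x \<in> X \<longrightarrow> tipdeg N \<le> dgr N X + 1" "A \<subset> nV N" "2 \<le> card A" "x \<in> A"
  shows "tipdeg N < dgr N A"
proof (rule ccontr)
  assume le: "\<not> tipdeg N < dgr N A"
  have "dgr N A \<le> dgr N X + 1" if "X \<subseteq> A" "x \<in> X" for X
  proof -
    have "X \<subseteq> nV N" using that assms by auto
    then have "tipdeg N \<le> dgr N X + 1" using assms(1) that by blast
    then show ?thesis using le by simp
  qed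
  then have "anchored N A (dgr N A)" using assms(4) by (auto simp: anchored_def)
  then show False using not_anchored assms by blast
qed

text \<open>Without tip edges a set and its complement have equal degree. In a set of minimum degree
  every vertex is an anchor, so such a set and its complement are single vertices; joined by at
  least four edges, they contradict \<open>no_parallel\<close>.\<close>

lemma tipdeg_pos: "0 < tipdeg N"
proof (rule ccontr)
  assume "\<not> 0 < tipdeg N"
  then have pq: "pin N v = 0" "pout N v = 0" if "v \<in> nV N" for v
    using that by (auto simp: tipdeg_def)
  have comp: "dgr N (nV N - A) = dgr N A" if "A \<subseteq> nV N" for A
  proof -
    have "(\<Sum>e\<in>nE N. of_bool ((tail N e \<in> nV N - A) \<noteq> (head N e \<in> nV N - A)) :: nat)
       = (\<Sum>e\<in>nE N. of_bool ((tail N e \<in> A) \<noteq> (head N e \<in> A)))"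
      using ends_in by (intro sum.cong) auto
    moreover have "(\<Sum>v\<in>nV N - A. pin N v + pout N v) = 0" "(\<Sum>v\<in>A. pin N v + pout N v) = 0"
      using pq that by (auto intro!: sum.neutral)
    ultimately show ?thesis by (simp add: dgr_def)
  qed
  obtain u where u: "u \<in> nV N" using nV_nonempty by blast
  have ex: "{u} \<noteq> {} \<and> {u} \<subset> nV N" using u not_single[of u] by auto
  obtain A where A0: "(A \<noteq> {} \<and> A \<subset> nV N) \<and> (\<forall>B. B \<noteq> {} \<and> B \<subset> nV N \<longrightarrow> dgr N A \<le> dgr N B)"
    using ex_has_least_nat[of "\<lambda>B. B \<noteq> {} \<and> B \<subset> nV N" "{u}" "dgr N", OF ex] by (elim exE)
  have A: "A \<noteq> {}" "A \<subset> nV N" using A0 by simp_all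
  have least: "dgr N A \<le> dgr N B" if "B \<noteq> {} \<and> B \<subset> nV N" for B
    using A0 that by blast
  have min: "\<not> 2 \<le> card B" if B: "B \<noteq> {}" "B \<subset> nV N" "dgr N B = dgr N A" for B
  proof
    assume c: "2 \<le> card B"
    have "dgr N B \<le> dgr N X + 1" if "X \<subseteq> B" "x \<in> X" for x X
    proof -
      have "X \<noteq> {} \<and> X \<subset> nV N" using that B by blast
      from least[OF this] show ?thesis using B(3) by simp
    qed
    then have "anchored N B (dgr N B)" using B(1) by (auto simp: anchored_def)
    then show False using not_anchored B c by blast
  qed
  have fin: "finite A" using A finX by blast
  have "card A = 1" using min[of A] A fin by (metis card_0_eq less_2_cases not_less One_nat_def)
  then obtain a where a: "A = {a}" by (auto simp: card_1_singleton_iff)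
  have "nV N - A \<noteq> {}" using A by auto
  moreover have "\<not> 2 \<le> card (nV N - A)" using min[of "nV N - A"] A comp[of A] by auto
  ultimately have "card (nV N - A) = 1"
    by (metis card_0_eq finV finite_Diff less_2_cases not_less One_nat_def)
  then obtain b where "nV N - A = {b}" by (auto simp: card_1_singleton_iff)
  then have V: "nV N = {a, b}" "a \<noteq> b" using a A by auto
  let ?F = "{e \<in> nE N. (tail N e \<in> A) \<noteq> (head N e \<in> A)}"
  have "dgr N A = card ?F" using pq[of a] V a by (simp add: dgr_def Int_def)
  moreover have "4 \<le> dgr N A" using A by (intro dgr4) auto
  ultimately have F: "finite ?F" "\<not> card ?F \<le> Suc 0" by auto
  then obtain e1 e2 where e: "e1 \<in> ?F" "e2 \<in> ?F" "e1 \<noteq> e2"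
    using card_le_Suc0_iff_eq by blast
  show False
    using no_parallel[of e1 e2 a b] no_parallel[of e1 e2 b a] e V a ends_in(1)[of e1] ends_in(2)[of e1] ends_in(1)[of e2] ends_in(2)[of e2]
    by auto
qed

end

subsection \<open>Vertices of degree four\<close>

context minimal_net
begin

text \<open>Shared check for all ways of removing \<open>v\<close>. Since \<open>v\<close> has zero
  boundary, \<open>X\<close> and \<open>insert v X\<close> have the same boundary modulo 3, so the
  first two alternatives inherit a certificate; the third is \<open>fine_lowered\<close>.\<close>

lemma remove_deg_4_admissible:
  assumes v: "v \<in> nV N" "dgr N {v} = 4"
    and M: "wf_net M" "nV M = nV N - {v}" "tipdeg M = tipdeg N"
    and bet: "\<And>X. X \<subseteq> nV N - {v} \<Longrightarrow> bet M X = bet N X"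
    and dgr: "\<And>X. X \<subseteq> nV N - {v} \<Longrightarrow> dgr M X = dgr N X \<or> dgr M X = dgr N (insert v X) \<or>
        dgr M X + 2 = dgr N X \<and> 2 \<le> card X"
  shows "admissible M"
proof -
  have psub: "X \<subset> nV N" if "X \<subseteq> nV N - {v}" for X using that v by auto
  have full: "dgr M (nV N - {v}) = tipdeg N" using dgr_nV[OF M(1)] M by simp
  have "good M" unfolding good_def M(2)
  proof (intro allI impI)
    fix X assume X: "X \<subseteq> nV N - {v}" "X \<noteq> {} \<and> X \<noteq> nV N - {v}"
    have fin: "finite X" using X(1) finX by blast
    have 1: "fine (dgr N X) (bet N X)" using X psub[OF X(1)] by (intro fineX) auto
    have "fine (dgr N (insert v X)) (bet N (insert v X))" using X v by (intro fineX) auto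
    moreover have "bet N (insert v X) = bet N {v} + bet N X"
      using X(1) fin by (intro bet_insert) auto
    ultimately have 2: "fine (dgr N (insert v X)) (bet N X)"
      using fine_add[OF bet_single_4[OF v]] by simp
    have 3: "fine (dgr M X) (bet N X)" if "dgr M X + 2 = dgr N X \<and> 2 \<le> card X"
      using that by (intro fine_lowered[OF psub[OF X(1)]]) auto
    show "fine (dgr M X) (bet M X)"
      using dgr[OF X(1)] bet[OF X(1)] 1 2 3 by auto
  qed
  moreover have "anchored M (nV M) (tipdeg M) \<or> twin_anchored M (nV M) (tipdeg M)"
    using anch
  proof
    assume "anchored N (nV N) (tipdeg N)"
    then obtain x where x: "x \<in> nV N" "\<forall>X\<subseteq>nV N. x \<in> X \<longrightarrow> tipdeg N \<le> dgr N X + 1"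
      by (auto simp: anchored_def)
    show ?thesis
    proof (cases "x = v")
      case True
      \<comment> \<open>As an anchor of degree 4, \<open>v\<close> forces a tip degree of at most 5,
        and then any other vertex can replace it.\<close>
      then have le: "tipdeg N \<le> 5" using x(2)[rule_format, of "{v}"] v by auto
      obtain w where w: "w \<in> nV N" "w \<noteq> v" using obtain_other .
      have "tipdeg N \<le> dgr M X + 1" if "X \<subseteq> nV N - {v}" "w \<in> X" for X
      proof (cases "X = nV N - {v}")
        case False
        then have "4 \<le> dgr M X"
          using \<open>good M\<close> that M(2) by (auto simp: good_def fine_def)
        then show ?thesis using le by simp
      qed (simp add: full)
      then have "anchored M (nV M) (tipdeg M)" using w M by (auto simp: anchored_def)
      then show ?thesis ..
    next
      case False
      have "tipdeg N \<le> dgr M X + 1" if X: "X \<subseteq> nV N - {v}" "x \<in> X" for X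
      proof -
        have "tipdeg N \<le> dgr N X + 1" "tipdeg N \<le> dgr N (insert v X) + 1"
          using x(2)[rule_format, of X] x(2)[rule_format, of "insert v X"] X v by auto
        moreover have "tipdeg N < dgr N X" if "2 \<le> card X"
          using dgr_anchor_gt[OF x(2) psub[OF X(1)] that X(2)] .
        ultimately show ?thesis using dgr[OF X(1)] by auto
      qed
      then have "anchored M (nV M) (tipdeg M)" using x(1) False M by (auto simp: anchored_def)
      then show ?thesis ..
    qed
  next
    assume "twin_anchored N (nV N) (tipdeg N)"
    then obtain x y where xy: "tipdeg N = 7" "x \<in> nV N" "y \<in> nV N" "x \<noteq> y"
      and 5: "\<And>X. X \<subseteq> nV N \<Longrightarrow> x \<in> X \<or> y \<in> X \<Longrightarrow> 5 \<le> dgr N X"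
      and 6: "\<And>X. X \<subseteq> nV N \<Longrightarrow> x \<in> X \<Longrightarrow> y \<in> X \<Longrightarrow> 6 \<le> dgr N X"
      by (auto simp: twin_anchored_def)
    have d: "5 \<le> dgr N {x}" "5 \<le> dgr N {y}" using 5[of "{x}"] 5[of "{y}"] xy by auto
    then have ne: "x \<noteq> v" "y \<noteq> v" using v by auto
    \<comment> \<open>Twin anchors have degree at least 5. So larger sets containing one of them do
      not have degree 6, and those containing both do not have degree 7; a loss of 2 is
      affordable.\<close>
    have ge7: "7 \<le> dgr N X" if X: "X \<subseteq> nV N - {v}" "2 \<le> card X" "x \<in> X \<or> y \<in> X" for X
      using dgr_ge_6[OF psub[OF X(1)] X(2)] dgr_6_single[OF psub[OF X(1)] X(2), of x]
        dgr_6_single[OF psub[OF X(1)] X(2), of y] d X(3)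
      by (cases "dgr N X = 6") auto
    have ge8: "8 \<le> dgr N X" if X: "X \<subseteq> nV N - {v}" "2 \<le> card X" "x \<in> X" "y \<in> X" for X
      using ge7[OF X(1,2)] dgr_7_unique[OF psub[OF X(1)] X(2) _ X(3,4) xy(4) d] X(3)
      by (cases "dgr N X = 7") auto
    have "5 \<le> dgr M X" if X: "X \<subseteq> nV N - {v}" "x \<in> X \<or> y \<in> X" for X
    proof -
      have "5 \<le> dgr N X" "5 \<le> dgr N (insert v X)" using X v by (auto intro!: 5)
      then show ?thesis using ge7[OF X(1) _ X(2)] dgr[OF X(1)] by auto
    qed
    moreover have "6 \<le> dgr M X" if X: "X \<subseteq> nV N - {v}" "x \<in> X" "y \<in> X" for X
    proof -
      have "6 \<le> dgr N X" "6 \<le> dgr N (insert v X)" using X v by (auto intro!: 6)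
      then show ?thesis using ge8[OF X(1) _ X(2,3)] dgr[OF X(1)] by auto
    qed
    ultimately have "twin_anchored M (nV M) (tipdeg M)"
      unfolding twin_anchored_def M(2,3) using xy ne by blast
    then show ?thesis ..
  qed
  ultimately show ?thesis using M(1) by (simp add: admissible_def)
qed

text \<open>Three tip edges at \<open>v\<close> would leave its complement with degree at most
  \<open>tipdeg N - 2\<close>, which is too small if an anchor lies there. If \<open>v\<close>
  itself is the anchor, the tip degree is at most 5 and the complement would have degree below
  4.\<close>

lemma deg_4_tip_le_2:
  assumes v: "v \<in> nV N" "dgr N {v} = 4" and out: "\<forall>e\<in>nE N. head N e = v \<longrightarrow> tail N e = v"
  shows "pin N v + pout N v \<le> 2"
proof (rule ccontr)
  assume "\<not> ?thesis"
  then have lt: "dgr N (nV N - {v}) + 2 \<le> tipdeg N"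
    using dgr_remove[OF wf v(1) out] v by simp
  have ne: "nV N - {v} \<noteq> {}" using not_single[of v] v by auto
  from anch show False
  proof
    assume "anchored N (nV N) (tipdeg N)"
    then obtain x where x: "x \<in> nV N" "\<forall>X\<subseteq>nV N. x \<in> X \<longrightarrow> tipdeg N \<le> dgr N X + 1"
      by (auto simp: anchored_def)
    show False
    proof (cases "x = v")
      case True
      then have "tipdeg N \<le> 5" using x(2)[rule_format, of "{v}"] v by auto
      moreover have "4 \<le> dgr N (nV N - {v})" using ne v by (intro dgr4) auto
      ultimately show False using lt by simp
    next
      case False
      then show False using x(2)[rule_format, of "nV N - {v}"] x(1) lt by auto
    qed
  next
    assume "twin_anchored N (nV N) (tipdeg N)"
    then obtain x y where xy: "tipdeg N = 7" "x \<in> nV N" "y \<in> nV N"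
      and 5: "\<And>X. X \<subseteq> nV N \<Longrightarrow> x \<in> X \<or> y \<in> X \<Longrightarrow> 5 \<le> dgr N X"
      and 6: "\<And>X. X \<subseteq> nV N \<Longrightarrow> x \<in> X \<Longrightarrow> y \<in> X \<Longrightarrow> 6 \<le> dgr N X"
      by (auto simp: twin_anchored_def)
    have "x \<noteq> v" "y \<noteq> v" using 5[of "{x}"] 5[of "{y}"] xy v by auto
    then show False using 6[of "nV N - {v}"] xy lt by auto
  qed
qed

end

section \<open>The view from one vertex whose edges all leave it\<close>

locale minimal_net_at = minimal_net +
  fixes v
  assumes v: "v \<in> nV N" and out: "\<And>e. e \<in> nE N \<Longrightarrow> head N e = v \<Longrightarrow> tail N e = v"
begin

text \<open>Loops at \<open>v\<close> belong neither to \<open>star\<close> nor to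
  \<open>rest\<close>; they affect no cut and no boundary.\<close>

definition star where "star = {e \<in> nE N. tail N e = v \<and> head N e \<noteq> v}"
definition rest where "rest = {e \<in> nE N. tail N e \<noteq> v}"

lemma fin_star [simp]: "finite star" and fin_rest [simp]: "finite rest" by (simp_all add: star_def rest_def)

lemma starD: "e \<in> star \<Longrightarrow> e \<in> nE N \<and> tail N e = v \<and> head N e \<noteq> v \<and> head N e \<in> nV N \<and> e \<notin> rest"
  using ends_in by (auto simp: star_def rest_def)

lemma restD: "e \<in> rest \<Longrightarrow> e \<in> nE N \<and> tail N e \<noteq> v \<and> head N e \<noteq> v \<and> e \<notin> star"
  using out by (auto simp: star_def rest_def)

lemma star_head_inj: "e \<in> star \<Longrightarrow> e' \<in> star \<Longrightarrow> head N e = head N e' \<Longrightarrow> e = e'"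
  using no_parallel[of e e' v "head N e"] starD[of e] starD[of e'] by metis

lemma inc_star: "e \<in> star \<Longrightarrow> u \<noteq> v \<Longrightarrow> inc N e u = - of_bool (head N e = u)"
  and inc_star_v: "e \<in> star \<Longrightarrow> inc N e v = 1"
  and inc_rest_v: "e \<in> rest \<Longrightarrow> inc N e v = 0"
  using starD[of e] restD[of e] by (simp_all add: inc_def)

lemma sum_split:
  fixes g :: "'b \<Rightarrow> 'c::comm_monoid_add"
  assumes "\<And>e. e \<in> nE N \<Longrightarrow> tail N e = v \<Longrightarrow> head N e = v \<Longrightarrow> g e = 0"
  shows "(\<Sum>e\<in>nE N. g e) = (\<Sum>e\<in>rest. g e) + (\<Sum>e\<in>star. g e)"
proof -
  have "(\<Sum>e\<in>nE N. g e) = (\<Sum>e\<in>rest \<union> star. g e)"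
    using assms by (intro sum.mono_neutral_right) (auto simp: star_def rest_def)
  also have "\<dots> = (\<Sum>e\<in>rest. g e) + (\<Sum>e\<in>star. g e)"
    by (intro sum.union_disjoint) (auto simp: star_def rest_def)
  finally show ?thesis .
qed

lemma dgr_v: "dgr N {v} = card star + pin N v + pout N v"
proof -
  have "(\<Sum>e\<in>nE N. of_bool ((tail N e \<in> {v}) \<noteq> (head N e \<in> {v})) :: nat)
     = (\<Sum>e\<in>rest. 0) + (\<Sum>e\<in>star. 1)"
    by (subst sum_split) (auto simp: restD starD intro!: arg_cong2[where f = "(+)"] sum.cong dest: restD starD)
  then show ?thesis by (simp add: dgr_def)
qed

lemma dgr_off:
  assumes "X \<subseteq> nV N - {v}"
  shows "dgr N X = (\<Sum>e\<in>rest. of_bool ((tail N e \<in> X) \<noteq> (head N e \<in> X))) +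
    (\<Sum>e\<in>star. of_bool (head N e \<in> X)) + (\<Sum>v\<in>X. pin N v + pout N v)"
proof -
  have "(\<Sum>e\<in>nE N. of_bool ((tail N e \<in> X) \<noteq> (head N e \<in> X)) :: nat)
     = (\<Sum>e\<in>rest. of_bool ((tail N e \<in> X) \<noteq> (head N e \<in> X))) + (\<Sum>e\<in>star. of_bool (head N e \<in> X))"
  proof (subst sum_split)
    have "(tail N e \<in> X) \<noteq> (head N e \<in> X) \<longleftrightarrow> head N e \<in> X" if "e \<in> star" for e
      using starD[OF that] assms by auto
    then have "(\<Sum>e\<in>star. of_bool ((tail N e \<in> X) \<noteq> (head N e \<in> X)) :: nat) = (\<Sum>e\<in>star. of_bool (head N e \<in> X))"
      by (intro sum.cong refl arg_cong[where f = of_bool])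
    then show "(\<Sum>e\<in>rest. of_bool ((tail N e \<in> X) \<noteq> (head N e \<in> X)) :: nat) + (\<Sum>e\<in>star. of_bool ((tail N e \<in> X) \<noteq> (head N e \<in> X)))
     = (\<Sum>e\<in>rest. of_bool ((tail N e \<in> X) \<noteq> (head N e \<in> X))) + (\<Sum>e\<in>star. of_bool (head N e \<in> X))"
      by (rule arg_cong)
  qed simp
  then show ?thesis by (simp add: dgr_def)
qed

lemma dgr_insert_v:
  assumes "X \<subseteq> nV N - {v}"
  shows "dgr N (insert v X) + 2 * (\<Sum>e\<in>star. of_bool (head N e \<in> X)) = dgr N X + dgr N {v}"
proof -
  have X: "finite X" "v \<notin> X" using assms finX by blast+
  have "(\<Sum>e\<in>nE N. of_bool (tail N e = v \<and> head N e \<in> X \<or> head N e = v \<and> tail N e \<in> X) :: nat)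
    = (\<Sum>e\<in>rest. 0) + (\<Sum>e\<in>star. of_bool (head N e \<in> X))"
  proof (subst sum_split)
    have 1: "\<not> (tail N e = v \<and> head N e \<in> X \<or> head N e = v \<and> tail N e \<in> X)" if "e \<in> rest" for e
      using restD[OF that] by auto
    have 2: "tail N e = v \<and> head N e \<in> X \<or> head N e = v \<and> tail N e \<in> X \<longleftrightarrow> head N e \<in> X" if "e \<in> star" for e
      using starD[OF that] by auto
    show "(\<Sum>e\<in>rest. of_bool (tail N e = v \<and> head N e \<in> X \<or> head N e = v \<and> tail N e \<in> X) :: nat)
      + (\<Sum>e\<in>star. of_bool (tail N e = v \<and> head N e \<in> X \<or> head N e = v \<and> tail N e \<in> X))
      = (\<Sum>e\<in>rest. 0) + (\<Sum>e\<in>star. of_bool (head N e \<in> X))"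
      by (intro arg_cong2[where f = "(+)"] sum.cong refl) (simp_all only: 1 2 of_bool_eq)
  qed (use X in simp)
  then show ?thesis using dgr_insert[OF X, of N] by simp
qed

lemma boundary_off:
  assumes "u \<noteq> v"
  shows "(\<Sum>e\<in>nE N. f e * inc N e u) = (\<Sum>e\<in>rest. f e * inc N e u) - (\<Sum>e\<in>star. f e * of_bool (head N e = u))"
proof -
  have "(\<Sum>e\<in>nE N. f e * inc N e u) = (\<Sum>e\<in>rest. f e * inc N e u) + (\<Sum>e\<in>star. f e * inc N e u)"
    using assms by (intro sum_split) (auto simp: inc_def)
  also have "(\<Sum>e\<in>star. f e * inc N e u) = (\<Sum>e\<in>star. - (f e * of_bool (head N e = u)))"
    using assms by (intro sum.cong) (auto simp: inc_star)
  finally show ?thesis by (simp add: sum_negf)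
qed

lemma boundary_v: "(\<Sum>e\<in>nE N. f e * inc N e v) = (\<Sum>e\<in>star. f e)"
proof -
  have "(\<Sum>e\<in>nE N. f e * inc N e v) = (\<Sum>e\<in>rest. f e * inc N e v) + (\<Sum>e\<in>star. f e * inc N e v)"
    by (intro sum_split) (auto simp: inc_def)
  also have "(\<Sum>e\<in>rest. f e * inc N e v) = (\<Sum>e\<in>rest. 0)"
    by (intro sum.cong) (auto simp: inc_rest_v)
  also have "(\<Sum>e\<in>star. f e * inc N e v) = (\<Sum>e\<in>star. f e)"
    by (intro sum.cong) (auto simp: inc_star_v)
  finally show ?thesis by simp
qed

text \<open>The common end of the reductions at \<open>v\<close>: a balanced assignment on
  \<open>rest\<close> and \<open>star\<close> becomes a flow once loops at \<open>v\<close> get the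
  value 1.\<close>

lemma no_flow_at:
  assumes "\<And>e. e \<in> rest \<union> star \<Longrightarrow> f e = 1 \<or> f e = -1"
    and "\<And>u. u \<in> nV N - {v} \<Longrightarrow>
      3 dvd (\<Sum>e\<in>rest. f e * inc N e u) - (\<Sum>e\<in>star. f e * of_bool (head N e = u)) - bd N u"
    and "3 dvd (\<Sum>e\<in>star. f e) - bd N v"
  shows False
proof -
  let ?g = "\<lambda>e. if e \<in> rest \<union> star then f e else 1"
  have g: "(\<Sum>e\<in>star. ?g e) = (\<Sum>e\<in>star. f e)" "(\<Sum>e\<in>rest. ?g e * inc N e u) = (\<Sum>e\<in>rest. f e * inc N e u)"
    "(\<Sum>e\<in>star. ?g e * of_bool (head N e = u)) = (\<Sum>e\<in>star. f e * of_bool (head N e = u))" for u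
    by (auto intro!: sum.cong)
  have "3 dvd (\<Sum>e\<in>nE N. ?g e * inc N e u) - bd N u" if "u \<in> nV N" for u
  proof (cases "u = v")
    case True
    then show ?thesis using assms(3) unfolding True boundary_v g by simp
  next
    case False
    then show ?thesis using assms(2)[of u] that unfolding boundary_off[OF False] g by simp
  qed
  then have "flow N ?g" using assms(1) by (auto simp: flow_def)
  then show False using noflow by blast
qed

lemma bd_v: "dgr N {v} = 4 \<Longrightarrow> 3 dvd bd N v - int (pin N v) + int (pout N v)"
  using bet_single_4[OF v] by (simp add: bet_def)

lemma sum_of_bool_pt: "finite X \<Longrightarrow> (\<Sum>u\<in>X. of_bool (u = a)) = (of_bool (a \<in> X) :: 'c::semiring_1)"
  by (simp add: of_bool_def sum.delta)

lemma sum_bd_remove: "(\<Sum>u\<in>nV N - {v}. bd N u) = (\<Sum>u\<in>nV N. bd N u) - bd N v"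
  using v by (simp add: sum_diff1)

lemma dvd_sum_bd: "3 dvd (\<Sum>u\<in>nV N. bd N u)"
  using wf by (simp add: wf_net_def)

end

section \<open>Splitting off a vertex of degree four\<close>

context minimal_net_at
begin

text \<open>The edges at \<open>v\<close> are replaced by new edges \<open>L\<close> and by \<open>dp u + dq u\<close> tip edges at \<open>u\<close>.\<close>

definition removal :: "'b set \<Rightarrow> ('b \<Rightarrow> 'a) \<Rightarrow> ('b \<Rightarrow> 'a) \<Rightarrow> ('a \<Rightarrow> nat) \<Rightarrow> ('a \<Rightarrow> nat) \<Rightarrow> ('a, 'b) net" where
  "removal L t h dp dq = \<lparr>nV = nV N - {v}, nE = rest \<union> L,
     tail = (\<lambda>e. if e \<in> L then t e else tail N e), head = (\<lambda>e. if e \<in> L then h e else head N e),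
     pin = (\<lambda>u. pin N u + dp u), pout = (\<lambda>u. pout N u + dq u),
     bd = (\<lambda>u. bd N u + int (dp u) - int (dq u))\<rparr>"

text \<open>The new edges reuse names from \<open>star\<close>. Here \<open>k\<close> counts the
  edges from \<open>v\<close> into \<open>X\<close>, and \<open>l\<close> the new edges cut by
  \<open>X\<close> plus the new tip edges at \<open>X\<close>. The replacement changes the degree of
  \<open>X\<close> by \<open>l - k\<close>, and adding \<open>v\<close> to \<open>X\<close> changes
  it by \<open>4 - 2 * k\<close>; hence the three alternatives are those of
  \<open>remove_deg_4_admissible\<close>.\<close>

lemma removal_obtains:
  assumes v4: "dgr N {v} = 4"
    and L: "L \<subseteq> star" "\<And>e. e \<in> L \<Longrightarrow> t e \<in> nV N - {v} \<and> h e \<in> nV N - {v}"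
    and tip: "(\<Sum>u\<in>nV N - {v}. dp u + dq u) = pin N v + pout N v"
    and bal: "3 dvd (\<Sum>u\<in>nV N - {v}. int (dp u) - int (dq u)) - bd N v"
    and cut: "\<And>X k l. X \<subseteq> nV N - {v} \<Longrightarrow> finite X \<Longrightarrow> k = (\<Sum>e\<in>star. of_bool (head N e \<in> X)) \<Longrightarrow>
      l = (\<Sum>e\<in>L. of_bool ((t e \<in> X) \<noteq> (h e \<in> X))) + (\<Sum>u\<in>X. dp u + dq u) \<Longrightarrow>
      l = k \<or> l + k = 4 \<or> k = l + 2 \<and> 2 \<le> card X"
  obtains g where "\<And>e. e \<in> rest \<union> L \<Longrightarrow> g e = 1 \<or> g e = -1"
    and "\<And>u. u \<in> nV N - {v} \<Longrightarrow> 3 dvd (\<Sum>e\<in>rest. g e * inc N e u) +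
      (\<Sum>e\<in>L. g e * (of_bool (t e = u) - of_bool (h e = u))) - (bd N u + int (dp u) - int (dq u))"
proof -
  let ?M = "removal L t h dp dq"
  have RL: "finite L" "rest \<inter> L = {}" "L \<subseteq> nE N" "rest \<subseteq> nE N" using L(1) by (auto simp: star_def rest_def intro: finite_subset)
  have notL: "e \<notin> L" if "e \<in> rest" for e using RL(2) that by blast
  have sum_rest_L: "(\<Sum>e\<in>rest \<union> L. k e) = (\<Sum>e\<in>rest. k e) + (\<Sum>e\<in>L. k e)" for k :: "'b \<Rightarrow> 'c::comm_monoid_add"
    using RL by (intro sum.union_disjoint) auto
  have "(\<Sum>u\<in>nV N - {v}. bd N u + int (dp u) - int (dq u)) =
      (\<Sum>u\<in>nV N - {v}. bd N u) + (\<Sum>u\<in>nV N - {v}. int (dp u) - int (dq u))"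
    by (simp add: sum.distrib[symmetric] add_diff_eq)
  also have "\<dots> = (\<Sum>u\<in>nV N. bd N u) + ((\<Sum>u\<in>nV N - {v}. int (dp u) - int (dq u)) - bd N v)"
    by (simp add: sum_bd_remove)
  finally have "3 dvd (\<Sum>u\<in>nV N - {v}. bd N u + int (dp u) - int (dq u))"
    using bal dvd_sum_bd by simp
  moreover have "tail ?M e \<in> nV N - {v} \<and> head ?M e \<in> nV N - {v}" if "e \<in> rest \<union> L" for e
    using that L(2)[of e] restD[of e] ends_in[of e] by (auto simp: removal_def)
  ultimately have wfM: "wf_net ?M"
    unfolding wf_net_def using RL(1) by (simp add: removal_def)
  have tipN: "tipdeg N = (\<Sum>u\<in>nV N - {v}. pin N u + pout N u) + pin N v + pout N v"
    using v by (simp add: tipdeg_def sum.remove)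
  have tipM: "tipdeg ?M = tipdeg N"
  proof -
    have "tipdeg ?M = (\<Sum>u\<in>nV N - {v}. pin N u + pout N u) + (\<Sum>u\<in>nV N - {v}. dp u + dq u)"
      by (simp add: tipdeg_def removal_def sum.distrib)
    then show ?thesis using tip tipN by simp
  qed
  have "admissible ?M"
  proof (rule remove_deg_4_admissible[OF v v4 wfM])
    show "nV ?M = nV N - {v}" by (simp add: removal_def)
    show "tipdeg ?M = tipdeg N" by (rule tipM)
  next
    fix X show "bet ?M X = bet N X" by (simp add: bet_def removal_def algebra_simps)
  next
    fix X assume X: "X \<subseteq> nV N - {v}"
    define k where "k = (\<Sum>e\<in>star. of_bool (head N e \<in> X) :: nat)"
    define l where "l = (\<Sum>e\<in>L. of_bool ((t e \<in> X) \<noteq> (h e \<in> X))) + (\<Sum>u\<in>X. dp u + dq u)"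
    have cR: "(\<Sum>e\<in>rest. of_bool ((tail ?M e \<in> X) \<noteq> (head ?M e \<in> X)) :: nat) = (\<Sum>e\<in>rest. of_bool ((tail N e \<in> X) \<noteq> (head N e \<in> X)))"
      by (intro sum.cong) (auto simp: removal_def notL)
    have cL: "(\<Sum>e\<in>L. of_bool ((tail ?M e \<in> X) \<noteq> (head ?M e \<in> X)) :: nat) = (\<Sum>e\<in>L. of_bool ((t e \<in> X) \<noteq> (h e \<in> X)))"
      by (intro sum.cong) (auto simp: removal_def)
    have "nE ?M = rest \<union> L" by (simp add: removal_def)
    moreover have "(\<Sum>u\<in>X. pin ?M u + pout ?M u) = (\<Sum>u\<in>X. pin N u + pout N u) + (\<Sum>u\<in>X. dp u + dq u)"
      by (simp add: removal_def sum.distrib)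
    ultimately have "dgr ?M X = (\<Sum>e\<in>rest. of_bool ((tail N e \<in> X) \<noteq> (head N e \<in> X))) + (\<Sum>u\<in>X. pin N u + pout N u) + l"
      unfolding dgr_def l_def by (simp only: sum_rest_L cR cL)
    then have "dgr ?M X + k = dgr N X + l"
      using dgr_off[OF X] by (simp add: k_def)
    moreover have "dgr N (insert v X) + 2 * k = dgr N X + 4"
      using dgr_insert_v[OF X] v4 by (simp add: k_def)
    moreover have "finite X" using X finX by blast
    ultimately show "dgr ?M X = dgr N X \<or> dgr ?M X = dgr N (insert v X) \<or> dgr ?M X + 2 = dgr N X \<and> 2 \<le> card X"
      using cut[OF X _ k_def l_def] by auto
  qed
  moreover have "net_size ?M < net_size N"
  proof -
    have "card (nV N - {v}) < card (nV N)" using v by (intro psubset_card_mono) auto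
    moreover have "card (rest \<union> L) \<le> card (nE N)" using RL by (intro card_mono) auto
    ultimately show ?thesis unfolding net_size_def tipM by (simp add: removal_def)
  qed
  ultimately obtain g where g: "flow ?M g" using smaller by blast
  show ?thesis
  proof (rule that)
    show "g e = 1 \<or> g e = -1" if "e \<in> rest \<union> L" for e using g that by (simp add: flow_def removal_def)
    fix u assume "u \<in> nV N - {v}"
    then have "3 dvd (\<Sum>e\<in>rest \<union> L. g e * inc ?M e u) - bd ?M u" using g by (simp add: flow_def removal_def)
    moreover have "(\<Sum>e\<in>rest. g e * inc ?M e u) = (\<Sum>e\<in>rest. g e * inc N e u)"
      by (intro sum.cong) (auto simp: removal_def inc_def notL)
    moreover have "(\<Sum>e\<in>L. g e * inc ?M e u) = (\<Sum>e\<in>L. g e * (of_bool (t e = u) - of_bool (h e = u)))"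
      by (intro sum.cong) (auto simp: removal_def inc_def)
    ultimately show "3 dvd (\<Sum>e\<in>rest. g e * inc N e u) +
      (\<Sum>e\<in>L. g e * (of_bool (t e = u) - of_bool (h e = u))) - (bd N u + int (dp u) - int (dq u))"
      unfolding sum_rest_L by (simp add: removal_def)
  qed
qed

lemma two_le_card: "finite X \<Longrightarrow> a \<in> X \<Longrightarrow> b \<in> X \<Longrightarrow> a \<noteq> b \<Longrightarrow> 2 \<le> card X"
  using card_mono[of X "{a, b}"] by auto

lemma sum_rest_cong: "(\<And>e. e \<in> rest \<Longrightarrow> f e = g e) \<Longrightarrow> (\<Sum>e\<in>rest. f e * inc N e u) = (\<Sum>e\<in>rest. g e * inc N e u)"
  by (intro sum.cong) auto

text \<open>The four edges at \<open>v\<close> are paired: two are replaced by an edge from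
  \<open>a\<close> to \<open>b\<close>, two by an edge from \<open>c\<close> to \<open>d\<close>.
  The ends of a pair differ since parallel edges are excluded, so a set that contains a whole pair
  has two vertices.\<close>

lemma no_deg_4_tip_0:
  assumes v4: "dgr N {v} = 4" and tip: "pin N v + pout N v = 0"
  shows False
proof -
  have "card star = Suc 3" using dgr_v v4 tip by simp
  then obtain e1 star' where star': "star = insert e1 star'" "e1 \<notin> star'" "card star' = 3"
    using card_eq_SucD[of star 3] by blast
  then obtain e2 e3 e4 where F234: "star' = {e2, e3, e4}" "e2 \<noteq> e3" "e2 \<noteq> e4" "e3 \<noteq> e4"
    by (auto simp: card_3_iff)
  have star: "star = {e1, e2, e3, e4}" using star' F234 by simp
  have e: "e1 \<noteq> e2" "e1 \<noteq> e3" "e1 \<noteq> e4" "e2 \<noteq> e3" "e2 \<noteq> e4" "e3 \<noteq> e4" using star' F234 by auto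
  define a b c d where abcd: "a = head N e1" "b = head N e2" "c = head N e3" "d = head N e4"
  have ne: "a \<noteq> b" "c \<noteq> d" using star_head_inj[of e1 e2] star_head_inj[of e3 e4] star e by (auto simp: abcd)
  have V: "a \<in> nV N - {v}" "b \<in> nV N - {v}" "c \<in> nV N - {v}" "d \<in> nV N - {v}"
    unfolding abcd using star starD by auto
  have nR: "e1 \<notin> rest" "e2 \<notin> rest" "e3 \<notin> rest" "e4 \<notin> rest" using star starD by auto
  have pq: "pin N v = 0" "pout N v = 0" using tip by auto
  obtain g where gs: "\<And>e. e \<in> rest \<union> {e1, e3} \<Longrightarrow> g e = 1 \<or> g e = -1"
    and g: "\<And>u. u \<in> nV N - {v} \<Longrightarrow> 3 dvd (\<Sum>e\<in>rest. g e * inc N e u) +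
      (\<Sum>e\<in>{e1, e3}. g e * (of_bool ((if e = e1 then a else c) = u) - of_bool ((if e = e1 then b else d) = u)))
      - (bd N u + int 0 - int 0)"
  proof (rule removal_obtains[OF v4, of "{e1, e3}" "\<lambda>e. if e = e1 then a else c" "\<lambda>e. if e = e1 then b else d"
        "\<lambda>_. 0" "\<lambda>_. 0"])
    show "{e1, e3} \<subseteq> star" using star by simp
    show "(if e = e1 then a else c) \<in> nV N - {v} \<and> (if e = e1 then b else d) \<in> nV N - {v}" for e
      using V by simp
    show "(\<Sum>u\<in>nV N - {v}. 0 + 0) = pin N v + pout N v" using pq by simp
    show "3 dvd (\<Sum>u\<in>nV N - {v}. int 0 - int 0) - bd N v" using bd_v[OF v4] pq by simp
  next
    fix X and k l :: nat assume X: "X \<subseteq> nV N - {v}" "finite X" and k: "k = (\<Sum>e\<in>star. of_bool (head N e \<in> X))"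
      and l: "l = (\<Sum>e\<in>{e1, e3}. of_bool (((if e = e1 then a else c) \<in> X) \<noteq> ((if e = e1 then b else d) \<in> X))) + (\<Sum>u\<in>X. 0 + 0)"
    have k: "k = of_bool (a \<in> X) + of_bool (b \<in> X) + of_bool (c \<in> X) + of_bool (d \<in> X)"
      unfolding k star using e by (simp add: abcd)
    have l: "l = of_bool ((a \<in> X) \<noteq> (b \<in> X)) + of_bool ((c \<in> X) \<noteq> (d \<in> X))"
      unfolding l using e by simp
    show "l = k \<or> l + k = 4 \<or> k = l + 2 \<and> 2 \<le> card X"
      using two_le_card[OF X(2), of a b] two_le_card[OF X(2), of c d] ne unfolding k l by auto
  qed blast
  \<comment> \<open>A new edge from \<open>a\<close> to \<open>b\<close> is rerouted through
    \<open>v\<close>. As \<open>v\<close> is the tail of both old edges, the one at \<open>a\<close>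
    gets the opposite sign.\<close>
  define f where "f = g(e1 := - g e1, e2 := g e1, e3 := - g e3, e4 := g e3)"
  have fR: "f e = g e" if "e \<in> rest" for e using nR that by (auto simp: f_def)
  have fRs: "(\<Sum>e\<in>rest. f e * inc N e u) = (\<Sum>e\<in>rest. g e * inc N e u)" for u by (intro sum_rest_cong fR)
  have f: "f e1 = - g e1" "f e2 = g e1" "f e3 = - g e3" "f e4 = g e3" using e by (auto simp: f_def)
  show False
  proof (rule no_flow_at[of f])
    fix e0 assume "e0 \<in> rest \<union> star"
    then show "f e0 = 1 \<or> f e0 = -1"
      using gs[of e0] gs[of e1] gs[of e3] fR[of e0] f unfolding star by auto
  next
    fix u assume u: "u \<in> nV N - {v}"
    show "3 dvd (\<Sum>e\<in>rest. f e * inc N e u) - (\<Sum>e\<in>star. f e * of_bool (head N e = u)) - bd N u"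
      using g[OF u] e unfolding star fRs by (simp add: f abcd algebra_simps del: sum_mult_of_bool_eq)
  next
    have "3 dvd bd N v" using bd_v[OF v4] pq by simp
    then show "3 dvd (\<Sum>e\<in>star. f e) - bd N v" unfolding star using e by (simp add: f)
  qed
qed

text \<open>One edge becomes a tip edge at \<open>a\<close>, the other two become an edge from
  \<open>b\<close> to \<open>c\<close>, which passes through \<open>v\<close> without effect on its
  balance. The sign \<open>s\<close> exists because a vertex of degree 4 has zero boundary, so its
  single tip edge forces \<open>bd N v\<close> to be 1 or -1 modulo 3.\<close>

lemma no_deg_4_tip_1:
  assumes v4: "dgr N {v} = 4" and tip: "pin N v + pout N v = 1"
  shows False
proof -
  have "card star = 3" using dgr_v v4 tip by simp
  then obtain e1 e2 e3 where star: "star = {e1, e2, e3}" and e: "e1 \<noteq> e2" "e1 \<noteq> e3" "e2 \<noteq> e3"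
    by (auto simp: card_3_iff)
  define a b c where abc: "a = head N e1" "b = head N e2" "c = head N e3"
  have ne: "b \<noteq> c" using star_head_inj[of e2 e3] star e by (auto simp: abc)
  have V: "a \<in> nV N - {v}" "b \<in> nV N - {v}" "c \<in> nV N - {v}"
    unfolding abc using star starD by auto
  have nR: "e1 \<notin> rest" "e2 \<notin> rest" "e3 \<notin> rest" using star starD by auto
  obtain s :: int where s: "s = 1 \<or> s = -1" "3 dvd s - bd N v"
  proof -
    have "pin N v = 1 \<and> pout N v = 0 \<or> pin N v = 0 \<and> pout N v = 1" using tip by auto
    then have "3 dvd 1 - bd N v \<or> 3 dvd (-1) - bd N v" using bd_v[OF v4] by presburger
    then show ?thesis using that by metis
  qed
  \<comment> \<open>For \<open>s = 1\<close> the edge goes from \<open>v\<close> to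
    \<open>a\<close>, so it survives as a tip edge entering \<open>a\<close>.\<close>
  define dp dq :: "'a \<Rightarrow> nat" where "dp = (\<lambda>u. of_bool (u = a \<and> s = 1))" and "dq = (\<lambda>u. of_bool (u = a \<and> s = -1))"
  have dsum: "dp u + dq u = of_bool (u = a)" and ddiff: "int (dp u) - int (dq u) = s * of_bool (u = a)" for u
    using s(1) by (auto simp: dp_def dq_def)
  obtain g where gs: "\<And>e. e \<in> rest \<union> {e2} \<Longrightarrow> g e = 1 \<or> g e = -1"
    and g: "\<And>u. u \<in> nV N - {v} \<Longrightarrow> 3 dvd (\<Sum>e\<in>rest. g e * inc N e u) +
      (\<Sum>e\<in>{e2}. g e * (of_bool (b = u) - of_bool (c = u))) - (bd N u + int (dp u) - int (dq u))"
  proof (rule removal_obtains[OF v4, of "{e2}" "\<lambda>_. b" "\<lambda>_. c" dp dq])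
    show "{e2} \<subseteq> star" using star by simp
    show "b \<in> nV N - {v} \<and> c \<in> nV N - {v}" using V by simp
    show "(\<Sum>u\<in>nV N - {v}. dp u + dq u) = pin N v + pout N v"
      unfolding dsum using tip V by (simp add: sum_of_bool_pt)
    show "3 dvd (\<Sum>u\<in>nV N - {v}. int (dp u) - int (dq u)) - bd N v"
      unfolding ddiff sum_distrib_left[symmetric] using s V by (simp add: sum_of_bool_pt)
  next
    fix X and k l :: nat assume X: "X \<subseteq> nV N - {v}" "finite X" and k: "k = (\<Sum>e\<in>star. of_bool (head N e \<in> X))"
      and l: "l = (\<Sum>e\<in>{e2}. of_bool ((b \<in> X) \<noteq> (c \<in> X))) + (\<Sum>u\<in>X. dp u + dq u)"
    have k: "k = of_bool (a \<in> X) + of_bool (b \<in> X) + of_bool (c \<in> X)"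
      unfolding k star using e by (simp add: abc)
    have l: "l = of_bool ((b \<in> X) \<noteq> (c \<in> X)) + of_bool (a \<in> X)"
      unfolding l dsum using X by (simp add: sum_of_bool_pt)
    show "l = k \<or> l + k = 4 \<or> k = l + 2 \<and> 2 \<le> card X"
      using two_le_card[OF X(2), of b c] ne unfolding k l by auto
  qed blast
  define f where "f = g(e1 := s, e2 := - g e2, e3 := g e2)"
  have fR: "f e = g e" if "e \<in> rest" for e using nR that by (auto simp: f_def)
  have fRs: "(\<Sum>e\<in>rest. f e * inc N e u) = (\<Sum>e\<in>rest. g e * inc N e u)" for u by (intro sum_rest_cong fR)
  have f: "f e1 = s" "f e2 = - g e2" "f e3 = g e2" using e by (auto simp: f_def)
  show False
  proof (rule no_flow_at[of f])
    fix e0 assume "e0 \<in> rest \<union> star"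
    then show "f e0 = 1 \<or> f e0 = -1"
      using gs[of e0] gs[of e2] fR[of e0] f s(1) unfolding star by auto
  next
    fix u assume u: "u \<in> nV N - {v}"
    have "bd N u + int (dp u) - int (dq u) = bd N u + s * of_bool (a = u)"
      using ddiff[of u] by (auto simp: eq_commute)
    then show "3 dvd (\<Sum>e\<in>rest. f e * inc N e u) - (\<Sum>e\<in>star. f e * of_bool (head N e = u)) - bd N u"
      using g[OF u] e unfolding star fRs by (simp add: f abc algebra_simps del: sum_mult_of_bool_eq)
  next
    show "3 dvd (\<Sum>e\<in>star. f e) - bd N v" unfolding star using e s by (simp add: f)
  qed
qed

text \<open>Both edges become tip edges, with signs chosen to balance \<open>v\<close>. No set
  avoiding \<open>v\<close> changes its degree.\<close>

lemma no_deg_4_tip_2: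
  assumes v4: "dgr N {v} = 4" and tip: "pin N v + pout N v = 2"
  shows False
proof -
  have "card star = 2" using dgr_v v4 tip by simp
  then obtain e1 e2 where star: "star = {e1, e2}" and e: "e1 \<noteq> e2"
    by (auto simp: card_2_iff)
  define a b where ab: "a = head N e1" "b = head N e2"
  have V: "a \<in> nV N - {v}" "b \<in> nV N - {v}" unfolding ab using star starD by auto
  have nR: "e1 \<notin> rest" "e2 \<notin> rest" using star starD by auto
  obtain s1 s2 :: int where s: "s1 = 1 \<or> s1 = -1" "s2 = 1 \<or> s2 = -1" "3 dvd s1 + s2 - bd N v"
    by (rule two_signs)
  define dp dq :: "'a \<Rightarrow> nat" where "dp = (\<lambda>u. of_bool (u = a \<and> s1 = 1) + of_bool (u = b \<and> s2 = 1))"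
    and "dq = (\<lambda>u. of_bool (u = a \<and> s1 = -1) + of_bool (u = b \<and> s2 = -1))"
  have dsum: "dp u + dq u = of_bool (u = a) + of_bool (u = b)"
    and ddiff: "int (dp u) - int (dq u) = s1 * of_bool (u = a) + s2 * of_bool (u = b)" for u
    using s by (auto simp: dp_def dq_def)
  obtain g where gs: "\<And>e. e \<in> rest \<union> {} \<Longrightarrow> g e = 1 \<or> g e = -1"
    and g: "\<And>u. u \<in> nV N - {v} \<Longrightarrow> 3 dvd (\<Sum>e\<in>rest. g e * inc N e u) +
      (\<Sum>e\<in>{}. g e * (of_bool (a = u) - of_bool (b = u))) - (bd N u + int (dp u) - int (dq u))"
  proof (rule removal_obtains[OF v4, of "{}" "\<lambda>_. a" "\<lambda>_. b" dp dq])
    show "(\<Sum>u\<in>nV N - {v}. dp u + dq u) = pin N v + pout N v"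
      unfolding dsum using tip V by (simp add: sum.distrib sum_of_bool_pt)
    show "3 dvd (\<Sum>u\<in>nV N - {v}. int (dp u) - int (dq u)) - bd N v"
      unfolding ddiff sum.distrib sum_distrib_left[symmetric] using s V by (simp add: sum_of_bool_pt)
  next
    fix X and k l :: nat assume X: "X \<subseteq> nV N - {v}" "finite X" and k: "k = (\<Sum>e\<in>star. of_bool (head N e \<in> X))"
      and l: "l = (\<Sum>e\<in>{}. of_bool ((a \<in> X) \<noteq> (b \<in> X))) + (\<Sum>u\<in>X. dp u + dq u)"
    have "k = of_bool (a \<in> X) + of_bool (b \<in> X)"
      unfolding k star using e by (simp add: ab)
    moreover have "l = of_bool (a \<in> X) + of_bool (b \<in> X)"
      unfolding l dsum using X by (simp add: sum.distrib sum_of_bool_pt)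
    ultimately show "l = k \<or> l + k = 4 \<or> k = l + 2 \<and> 2 \<le> card X" by simp
  qed (use V in auto)
  define f where "f = g(e1 := s1, e2 := s2)"
  have fR: "f e = g e" if "e \<in> rest" for e using nR that by (auto simp: f_def)
  have fRs: "(\<Sum>e\<in>rest. f e * inc N e u) = (\<Sum>e\<in>rest. g e * inc N e u)" for u by (intro sum_rest_cong fR)
  have f: "f e1 = s1" "f e2 = s2" using e by (auto simp: f_def)
  show False
  proof (rule no_flow_at[of f])
    fix e0 assume "e0 \<in> rest \<union> star"
    then show "f e0 = 1 \<or> f e0 = -1"
      using gs[of e0] fR[of e0] f s unfolding star by auto
  next
    fix u assume u: "u \<in> nV N - {v}"
    have "bd N u + int (dp u) - int (dq u) = bd N u + (s1 * of_bool (a = u) + s2 * of_bool (b = u))"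
      using ddiff[of u] by (auto simp: eq_commute)
    then show "3 dvd (\<Sum>e\<in>rest. f e * inc N e u) - (\<Sum>e\<in>star. f e * of_bool (head N e = u)) - bd N u"
      using g[OF u] e unfolding star fRs by (simp add: f ab algebra_simps del: sum_mult_of_bool_eq)
  next
    show "3 dvd (\<Sum>e\<in>star. f e) - bd N v" unfolding star using e s by (simp add: f)
  qed
qed

lemma dgr_v_ge_5: "5 \<le> dgr N {v}"
proof -
  have False if v4: "dgr N {v} = 4"
  proof -
    have "pin N v + pout N v \<le> 2" using deg_4_tip_le_2[OF v v4] out by blast
    then consider "pin N v + pout N v = 0" | "pin N v + pout N v = 1" | "pin N v + pout N v = 2" by linarith
    then show False using no_deg_4_tip_0[OF v4] no_deg_4_tip_1[OF v4] no_deg_4_tip_2[OF v4] by cases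
  qed
  then have "dgr N {v} \<noteq> 4" by blast
  then show ?thesis using fine_single[OF v] by (simp add: fine_def)
qed

end

text \<open>Carries the results about a vertex whose edges all leave it over to an arbitrary
  vertex.\<close>

lemma (in minimal_net) minimal_net_at_orient_out:
  assumes "u \<in> nV N" shows "minimal_net_at (orient_out N u) u"
proof -
  interpret O: minimal_net "orient_out N u" by (rule minimal_orient_out)
  show ?thesis using assms by unfold_locales (auto simp: orient_out_def)
qed

context minimal_net
begin

lemma dgr_single_ge_5: "u \<in> nV N \<Longrightarrow> 5 \<le> dgr N {u}"
  using minimal_net_at.dgr_v_ge_5[OF minimal_net_at_orient_out] by (simp add: dgr_orient_out)

text \<open>Degree 6 would need vertices of degree 4, and degree 7 allows only one vertex of degree
  at least 5.\<close>

lemma dgr_ge_8: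
  assumes "A \<subset> nV N" "2 \<le> card A"
  shows "8 \<le> dgr N A"
proof -
  obtain a b where ab: "a \<in> A" "b \<in> A" "a \<noteq> b"
    using assms(2) by (auto simp: numeral_2_eq_2 card_le_Suc_iff)
  have "5 \<le> dgr N {a}" "5 \<le> dgr N {b}" using ab assms dgr_single_ge_5 by auto
  then have "dgr N A \<noteq> 6" "dgr N A \<noteq> 7"
    using dgr_6_single[OF assms _ ab(1)] dgr_7_unique[OF assms _ ab] by auto
  then show ?thesis using dgr_ge_6[OF assms] by simp
qed

end

subsection \<open>Vertices of degree at least five\<close>

lemma fine_ge_6: "6 \<le> d \<Longrightarrow> fine d s"
  by (simp add: fine_def)

text \<open>A tip edge into \<open>u\<close> cannot be deleted without violating the degree condition at \<open>u\<close>.\<close>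

definition resistant :: "('v, 'e) net \<Rightarrow> 'v \<Rightarrow> bool" where
  "resistant N u \<longleftrightarrow> dgr N {u} = 5 \<and> 3 dvd bet N {u} - 1 \<or> dgr N {u} = 6 \<and> 3 dvd bet N {u} + 1"

text \<open>The residues that forbid a loss of one edge with a boundary shift of \<open>+ 1\<close>
  permit it with the shift \<open>- 1\<close>.\<close>

lemma resistant_fine:
  assumes "resistant N u"
  shows "fine (dgr N {u} - 1) (bet N {u} - 1)"
  using assms unfolding resistant_def fine_def by (elim disjE) (simp, simp, presburger)

lemma not_resistant_fine:
  assumes "\<not> resistant N u" "5 \<le> dgr N {u}" "fine (dgr N {u}) (bet N {u})"
  shows "fine (dgr N {u} - 1) (bet N {u} + 1)"
proof -
  consider "dgr N {u} = 5" | "dgr N {u} = 6" | "7 \<le> dgr N {u}" using assms(2) by linarith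
  then show ?thesis
  proof cases
    case 1
    then have "\<not> 3 dvd bet N {u}" "\<not> 3 dvd bet N {u} - 1" using assms by (auto simp: fine_def resistant_def)
    then have "3 dvd bet N {u} + 1" by presburger
    then show ?thesis using 1 by (simp add: fine_def)
  next
    case 2
    then show ?thesis using assms(1) by (auto simp: fine_def resistant_def)
  qed (simp add: fine_ge_6)
qed

text \<open>For tip degree at most 5 any vertex is an anchor, for 6 a vertex of degree 5 is, and for
  7 two such vertices are twin anchors. For small tip degree the old anchor need not be followed
  through a reduction.\<close>

lemma admissible_small:
  assumes wfM: "wf_net M" and gM: "good M" and ne: "nV M \<noteq> {}" and le7: "tipdeg M \<le> 7"
    and big: "\<And>X. X \<subset> nV M \<Longrightarrow> 2 \<le> card X \<Longrightarrow> 6 \<le> dgr M X"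
    and 6: "tipdeg M = 6 \<Longrightarrow> \<exists>t\<in>nV M. 5 \<le> dgr M {t}"
    and 7: "tipdeg M = 7 \<Longrightarrow> \<exists>t\<in>nV M. \<exists>t'\<in>nV M. t \<noteq> t' \<and> 5 \<le> dgr M {t} \<and> 5 \<le> dgr M {t'}"
  shows "admissible M"
proof -
  have fin: "finite (nV M)" using wfM by (simp add: wf_net_def)
  have full: "dgr M (nV M) = tipdeg M" by (rule dgr_nV[OF wfM])
  have sub: "X = {x} \<or> 6 \<le> dgr M X \<or> X = nV M" if X: "X \<subseteq> nV M" "x \<in> X" for X x
  proof (cases "X = {x} \<or> X = nV M")
    case False
    have "finite X" using X fin finite_subset by blast
    then have "card {x} < card X" using X False by (intro psubset_card_mono) auto
    then show ?thesis using big[of X] X False by auto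
  qed auto
  consider "tipdeg M \<le> 5" | "tipdeg M = 6" | "tipdeg M = 7" using le7 by linarith
  then have "anchored M (nV M) (tipdeg M) \<or> twin_anchored M (nV M) (tipdeg M)"
  proof cases
    case 1
    obtain x where x: "x \<in> nV M" using ne by blast
    have "tipdeg M \<le> dgr M X + 1" if "X \<subseteq> nV M" "x \<in> X" for X
    proof (cases "X = nV M")
      case False
      then have "4 \<le> dgr M X" using gM that by (auto simp: good_def fine_def)
      then show ?thesis using 1 by simp
    qed (simp add: full)
    then show ?thesis using x by (auto simp: anchored_def)
  next
    case 2
    obtain t where t: "t \<in> nV M" "5 \<le> dgr M {t}" using 6[OF 2] by blast
    have "tipdeg M \<le> dgr M X + 1" if "X \<subseteq> nV M" "t \<in> X" for X
      using sub[OF that] t 2 full by auto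
    then show ?thesis using t by (auto simp: anchored_def)
  next
    case 3
    obtain t t' where t: "t \<in> nV M" "t' \<in> nV M" "t \<noteq> t'" "5 \<le> dgr M {t}" "5 \<le> dgr M {t'}"
      using 7[OF 3] by blast
    have "5 \<le> dgr M X" if "X \<subseteq> nV M" "t \<in> X \<or> t' \<in> X" for X
      using sub[OF that(1), of t] sub[OF that(1), of t'] that(2) t(4,5) 3 full by auto
    moreover have "6 \<le> dgr M X" if "X \<subseteq> nV M" "t \<in> X" "t' \<in> X" for X
      using sub[OF that(1,2)] that(3) t(3) 3 full by auto
    ultimately show ?thesis unfolding twin_anchored_def using 3 t(1-3) by blast
  qed
  then show ?thesis using wfM gM by (simp add: admissible_def)
qed

section \<open>Deleting a tip edge\<close>

context minimal_net
begin

lemma single_or_dgr_ge_8: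
  assumes "X \<subseteq> nV N" "X \<noteq> nV N" "x \<in> X"
  shows "X = {x} \<or> 2 \<le> card X \<and> 8 \<le> dgr N X"
  using single_or_dgr_ge_6[of X X x] dgr_ge_8[of X] assms by auto

text \<open>Deleting a tip edge into \<open>w\<close> with \<open>bd\<close> kept leaves the flows
  unchanged. Only the certificate of \<open>{w}\<close> is in danger, because larger sets have
  degree at least 8. The tip degree falls by one as well, so an anchor survives; from twin anchors
  it falls to 6, where any other vertex serves.\<close>

lemma resistant_if_pin:
  assumes w: "w \<in> nV N" and pin: "1 \<le> pin N w"
  shows "resistant N w"
proof (rule ccontr)
  assume nr: "\<not> resistant N w"
  define M where "M = N\<lparr>pin := (pin N)(w := pin N w - 1)\<rparr>"
  have sel [simp]: "nV M = nV N" "nE M = nE N" "tail M = tail N" "head M = head N" "bd M = bd N"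
    "pout M = pout N" and pinM: "pin M = (pin N)(w := pin N w - 1)" by (simp_all add: M_def)
  have sums: "(\<Sum>u\<in>X. pin M u + pout M u) + of_bool (w \<in> X) = (\<Sum>u\<in>X. pin N u + pout N u)" if "finite X" for X
  proof -
    have "(\<Sum>u\<in>X. pin N u + pout N u) = (\<Sum>u\<in>X. (pin M u + pout M u) + of_bool (u = w))"
      using pin by (intro sum.cong) (auto simp: pinM)
    then show ?thesis using that by (simp add: sum.distrib of_bool_def sum.delta)
  qed
  have dg: "dgr M X + of_bool (w \<in> X) = dgr N X" if "finite X" for X
    using sums[OF that] by (simp add: dgr_def)
  have bt: "bet M X = bet N X + of_bool (w \<in> X)" if "finite X" for X
  proof -
    have "bet M X = (\<Sum>u\<in>X. (bd N u - int (pin N u) + int (pout N u)) + of_bool (u = w))"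
      unfolding bet_def using pin by (intro sum.cong) (auto simp: pinM of_nat_diff)
    then show ?thesis using that by (simp add: bet_def sum.distrib of_bool_def sum.delta)
  qed
  have tip: "tipdeg M + 1 = tipdeg N" using sums[of "nV N"] w by (simp add: tipdeg_def)
  have wfM: "wf_net M" using wf by (simp add: wf_net_def)
  have gM: "good M" unfolding good_def
  proof (intro allI impI)
    fix X assume "X \<subseteq> nV M" "X \<noteq> {} \<and> X \<noteq> nV M"
    then have X: "X \<subseteq> nV N" "X \<noteq> {}" "X \<noteq> nV N" by auto
    have fin: "finite X" using X finX by blast
    show "fine (dgr M X) (bet M X)"
    proof (cases "w \<in> X")
      case False
      then show ?thesis using dg[OF fin] bt[OF fin] fineX[OF X] by simp
    next
      case True
      from single_or_dgr_ge_8[OF X(1,3) True] show ?thesis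
      proof
        assume "X = {w}"
        then show ?thesis
          using not_resistant_fine[OF nr dgr_single_ge_5[OF w] fine_single[OF w]] dg[OF fin] bt[OF fin]
          by (simp flip: dg[of "{w}"])
      next
        assume "2 \<le> card X \<and> 8 \<le> dgr N X"
        then show ?thesis using dg[OF fin] True by (intro fine_ge_6) simp
      qed
    qed
  qed
  have "admissible M"
    using anch
  proof
    assume "anchored N (nV N) (tipdeg N)"
    then obtain x where x: "x \<in> nV N" "\<forall>X\<subseteq>nV N. x \<in> X \<longrightarrow> tipdeg N \<le> dgr N X + 1"
      by (auto simp: anchored_def)
    have "tipdeg M \<le> dgr M X + 1" if X: "X \<subseteq> nV N" "x \<in> X" for X
    proof -
      have "tipdeg N \<le> dgr N X + 1" using x X by blast
      moreover have "dgr N X \<le> dgr M X + 1" using dg[OF finX[OF X(1)]] by (simp split: if_splits add: of_bool_def)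
      ultimately show ?thesis using tip by simp
    qed
    then have "anchored M (nV M) (tipdeg M)" using x(1) by (auto simp: anchored_def)
    then show ?thesis using wfM gM by (simp add: admissible_def)
  next
    assume "twin_anchored N (nV N) (tipdeg N)"
    then have t: "tipdeg M = 6" using tip by (simp add: twin_anchored_def)
    obtain y where y: "y \<in> nV N" "y \<noteq> w" using obtain_other .
    show ?thesis
    proof (rule admissible_small[OF wfM gM])
      show "nV M \<noteq> {}" using w by auto
      show "\<exists>t\<in>nV M. 5 \<le> dgr M {t}"
        using y dgr_single_ge_5[OF y(1)] dg[of "{y}"] by (intro bexI[of _ y]) auto
      fix X assume X: "X \<subset> nV M" "2 \<le> card X"
      then have "8 \<le> dgr N X" by (intro dgr_ge_8) auto
      moreover have "finite X" using X finX[of X] by auto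
      ultimately show "6 \<le> dgr M X" using dg[of X] by (cases "w \<in> X") auto
    qed (use t in auto)
  qed
  moreover have "net_size M < net_size N" using tip by (simp add: net_size_def)
  ultimately obtain g where "flow M g" using smaller by blast
  then have "flow N g" by (simp add: flow_def inc_def)
  then show False using noflow by blast
qed

text \<open>With tip edges in both directions \<open>w\<close> would be resistant in
  \<open>N\<close> and in \<open>mirror N\<close>, which asks for opposite nonzero residues at the
  same degree.\<close>

lemma pout_zero_if_pin:
  assumes w: "w \<in> nV N" and pin: "1 \<le> pin N w"
  shows "pout N w = 0"
proof (rule ccontr)
  assume "pout N w \<noteq> 0"
  then have "resistant (mirror N) w"
    using w by (intro minimal_net.resistant_if_pin[OF minimal_mirror]) (auto simp: mirror_def)
  then show False using resistant_if_pin[OF w pin]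
    unfolding resistant_def dgr_mirror bet_mirror by presburger
qed

end

section \<open>Deleting an edge between two vertices other than the tip\<close>

context minimal_net_at
begin

text \<open>If the complement of \<open>v\<close> has two vertices, its degree is at least 8, which
  leaves at most two tip edges at \<open>v\<close>. If it is a single vertex, at most one edge joins
  it to \<open>v\<close>, and counting degrees gives a contradiction.\<close>

lemma card_star_ge_3:
  assumes r: "dgr N {v} = 5 \<or> dgr N {v} = 6" and le: "tipdeg N \<le> 7"
  shows "3 \<le> card star"
proof -
  have eq: "dgr N (nV N - {v}) + 2 * (pin N v + pout N v) = tipdeg N + dgr N {v}"
    using dgr_remove[OF wf v] out by blast
  obtain w where w: "w \<in> nV N - {v}" using obtain_other[of v] by blast
  show ?thesis
  proof (cases "nV N - {v} = {w}")
    case False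
    have "nV N - {v} \<noteq> nV N" using v by auto
    then have "8 \<le> dgr N (nV N - {v})"
      using single_or_dgr_ge_8[of "nV N - {v}" w] w False by auto
    then show ?thesis using eq le dgr_v r by presburger
  next
    case True
    have "card star \<le> 1"
    proof -
      have "\<forall>e\<in>star. \<forall>e'\<in>star. e = e'" using star_head_inj starD True by (metis Diff_iff singletonD singletonI)
      then show ?thesis by (simp add: card_le_Suc0_iff_eq)
    qed
    moreover have "5 \<le> dgr N {w}" using w by (intro dgr_single_ge_5) auto
    ultimately show ?thesis using eq le dgr_v r unfolding True by presburger
  qed
qed

text \<open>The complement of \<open>v\<close> contains the anchor, so its degree is at least
  \<open>tipdeg N - 1\<close>; this leaves at most three tip edges at \<open>v\<close>.\<close>

lemma card_star_ge_3_anchored: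
  assumes r: "dgr N {v} = 6" and x: "x \<in> nV N" "x \<noteq> v" "\<forall>X\<subseteq>nV N. x \<in> X \<longrightarrow> tipdeg N \<le> dgr N X + 1"
  shows "3 \<le> card star"
proof -
  have "dgr N (nV N - {v}) + 2 * (pin N v + pout N v) = tipdeg N + dgr N {v}"
    using dgr_remove[OF wf v] out by blast
  moreover have "tipdeg N \<le> dgr N (nV N - {v}) + 1" using x by blast
  ultimately show ?thesis using r dgr_v by presburger
qed

lemma obtain_heads:
  assumes "3 \<le> card star"
  obtains e e' where "e \<in> star" "e' \<in> star" "e \<noteq> e'" "head N e \<noteq> u" "head N e' \<noteq> u"
proof -
  let ?S = "{e \<in> star. head N e = u}"
  have "\<forall>e\<in>?S. \<forall>e'\<in>?S. e = e'" using star_head_inj by blast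
  then have "card ?S \<le> 1" by (simp add: card_le_Suc0_iff_eq)
  moreover have "card (star - ?S) = card star - card ?S" by (intro card_Diff_subset) auto
  ultimately have "\<not> card (star - ?S) \<le> Suc 0" using assms by linarith
  moreover have "finite (star - ?S)" by simp
  ultimately obtain e e' where "e \<in> star - ?S" "e' \<in> star - ?S" "e \<noteq> e'"
    using card_le_Suc0_iff_eq by blast
  then show ?thesis using that by blast
qed

text \<open>Giving \<open>e\<close> the sign \<open>s\<close> and deleting it shifts the boundary by
  \<open>- s\<close> at \<open>v\<close> and by \<open>s\<close> at \<open>u\<close>. If
  \<open>c\<close> holds, a tip edge into \<open>v\<close> is also reversed with \<open>bd\<close>
  kept, which adds 2 to the boundary of \<open>v\<close>. Larger sets lose at most one from degree
  8. By \<open>an\<close>, either \<open>v\<close> has two neighbours besides \<open>u\<close>,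
  whose degrees stay, or the anchor is neither end of \<open>e\<close>.\<close>

lemma edge_delete:
  assumes e: "e \<in> star" and u: "u = head N e" and s: "s = 1 \<or> s = -1" and c: "c \<Longrightarrow> 1 \<le> pin N v"
    and fv: "fine (dgr N {v} - 1) (bet N {v} - s + 2 * of_bool c)"
    and fu: "fine (dgr N {u} - 1) (bet N {u} + s)"
    and an: "tipdeg N \<le> 7 \<and> 3 \<le> card star \<or>
      x \<in> nV N \<and> x \<noteq> u \<and> x \<noteq> v \<and> (\<forall>X\<subseteq>nV N. x \<in> X \<longrightarrow> tipdeg N \<le> dgr N X + 1)"
  shows False
proof -
  define M where "M = N\<lparr>nE := nE N - {e}, bd := (bd N)(v := bd N v - s, u := bd N u + s),
    pin := (pin N)(v := pin N v - of_bool c), pout := (pout N)(v := pout N v + of_bool c)\<rparr>"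
  have sel [simp]: "nV M = nV N" "nE M = nE N - {e}" "tail M = tail N" "head M = head N"
    and bdM: "bd M = (bd N)(v := bd N v - s, u := bd N u + s)"
    and pM: "pin M = (pin N)(v := pin N v - of_bool c)" "pout M = (pout N)(v := pout N v + of_bool c)"
    by (simp_all add: M_def)
  have eN: "e \<in> nE N" "tail N e = v" "u \<noteq> v" "u \<in> nV N" using starD[OF e] u by auto
  have tp: "pin M w + pout M w = pin N w + pout N w" for w using c by (auto simp: pM)
  have cutE: "(\<Sum>e\<in>nE N. of_bool ((tail N e \<in> X) \<noteq> (head N e \<in> X)) :: nat) =
     of_bool ((v \<in> X) \<noteq> (u \<in> X)) + (\<Sum>e\<in>nE N - {e}. of_bool ((tail N e \<in> X) \<noteq> (head N e \<in> X)))" for X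
    using sum.remove[OF finE eN(1), of "\<lambda>e. of_bool ((tail N e \<in> X) \<noteq> (head N e \<in> X)) :: nat"] eN(2) u by simp
  have dg: "dgr M X + of_bool ((v \<in> X) \<noteq> (u \<in> X)) = dgr N X" for X
    unfolding dgr_def tp cutE by simp
  have bt: "bet M X = bet N X + (2 * of_bool c - s) * of_bool (v \<in> X) + s * of_bool (u \<in> X)" if "finite X" for X
  proof -
    have "bet M X = (\<Sum>w\<in>X. (bd N w - int (pin N w) + int (pout N w)) + ((2 * of_bool c - s) * of_bool (w = v) + s * of_bool (w = u)))"
      unfolding bet_def using eN(3) c by (intro sum.cong) (auto simp: of_nat_diff bdM pM)
    then show ?thesis
      using that sum_of_bool_pt[of X v, where 'c=int] sum_of_bool_pt[of X u, where 'c=int]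
      by (simp add: bet_def sum.distrib sum_distrib_left[symmetric] del: sum_mult_of_bool_eq)
  qed
  have tip: "tipdeg M = tipdeg N" unfolding tipdeg_def tp by simp
  have wfM: "wf_net M"
  proof -
    have "(\<Sum>w\<in>nV N. ((bd N)(v := bd N v - s, u := bd N u + s)) w)
      = (\<Sum>w\<in>nV N. bd N w + (s * of_bool (w = u) - s * of_bool (w = v)))"
      using eN by (intro sum.cong) auto
    also have "\<dots> = (\<Sum>w\<in>nV N. bd N w)"
      using v eN sum_of_bool_pt[of "nV N" v, where 'c=int] sum_of_bool_pt[of "nV N" u, where 'c=int]
      by (simp add: sum.distrib sum_subtractf sum_distrib_left[symmetric] del: sum_mult_of_bool_eq)
    finally show ?thesis using wf unfolding wf_net_def by (simp add: bdM)
  qed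
  have big: "7 \<le> dgr M X" if "X \<subset> nV N" "2 \<le> card X" for X
    using dgr_ge_8[OF that] dg[of X] by (simp add: of_bool_def split: if_splits)
  have gM: "good M" unfolding good_def
  proof (intro allI impI)
    fix X assume "X \<subseteq> nV M" "X \<noteq> {} \<and> X \<noteq> nV M"
    then have X: "X \<subseteq> nV N" "X \<noteq> {}" "X \<noteq> nV N" by auto
    have fin: "finite X" using X finX by blast
    obtain y where y: "y \<in> X" using X by blast
    from single_or_dgr_ge_8[OF X(1,3) y] show "fine (dgr M X) (bet M X)"
    proof
      assume X1: "X = {y}"
      have "dgr M {v} = dgr N {v} - 1" "dgr M {u} = dgr N {u} - 1"
        using dg[of "{v}"] dg[of "{u}"] eN(3) by auto
      moreover have "bet M {v} = bet N {v} - s + 2 * of_bool c" "bet M {u} = bet N {u} + s"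
        using bt[of "{v}"] bt[of "{u}"] eN(3) by auto
      moreover have "dgr M {y} = dgr N {y}" "bet M {y} = bet N {y}" if "y \<noteq> v" "y \<noteq> u"
        using that dg[of "{y}"] bt[of "{y}"] by auto
      ultimately show ?thesis
        using fv fu fineX[OF X] unfolding X1 by (cases "y = v"; cases "y = u") simp_all
    next
      assume "2 \<le> card X \<and> 8 \<le> dgr N X"
      then have "7 \<le> dgr M X" using X by (intro big) auto
      then show ?thesis by (intro fine_ge_6) simp
    qed
  qed
  have "admissible M"
    using an
  proof
    assume small: "tipdeg N \<le> 7 \<and> 3 \<le> card star"
    then obtain e1 e2 where e12: "e1 \<in> star" "e2 \<in> star" "e1 \<noteq> e2" "head N e1 \<noteq> u" "head N e2 \<noteq> u"
      using obtain_heads by blast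
    have hd: "head N e1 \<in> nV N" "head N e2 \<in> nV N" "head N e1 \<noteq> v" "head N e2 \<noteq> v" "head N e1 \<noteq> head N e2"
      using starD e12 star_head_inj by auto
    have "5 \<le> dgr M {head N e1}" "5 \<le> dgr M {head N e2}"
      using dg[of "{head N e1}"] dg[of "{head N e2}"] dgr_single_ge_5 hd e12 by auto
    then have two: "\<exists>t\<in>nV M. \<exists>t'\<in>nV M. t \<noteq> t' \<and> 5 \<le> dgr M {t} \<and> 5 \<le> dgr M {t'}"
      using hd(1,2,5) by auto
    show ?thesis
    proof (rule admissible_small[OF wfM gM])
      show "nV M \<noteq> {}" using v by auto
      show "tipdeg M \<le> 7" using tip small by simp
      show "6 \<le> dgr M X" if "X \<subset> nV M" "2 \<le> card X" for X using big[of X] that by simp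
      show "\<exists>t\<in>nV M. 5 \<le> dgr M {t}" using two by blast
    qed (rule two)
  next
    assume x: "x \<in> nV N \<and> x \<noteq> u \<and> x \<noteq> v \<and> (\<forall>X\<subseteq>nV N. x \<in> X \<longrightarrow> tipdeg N \<le> dgr N X + 1)"
    have "tipdeg M \<le> dgr M X + 1" if X: "X \<subseteq> nV N" "x \<in> X" for X
    proof -
      have le: "tipdeg N \<le> dgr N X + 1" using x X by blast
      consider "X = nV N" | "X = {x}" | "X \<subset> nV N" "2 \<le> card X"
        using single_or_dgr_ge_8[OF X(1) _ X(2)] X(1) by auto
      then show ?thesis
      proof cases
        case 1
        then show ?thesis using le dg[of X] tip v eN by simp
      next
        case 2
        have "v \<noteq> x" "u \<noteq> x" using x by blast+
        then have "dgr M {x} = dgr N {x}" using dg[of "{x}"] by simp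
        then show ?thesis using le tip 2 by simp
      next
        case 3
        have "tipdeg N < dgr N X" using dgr_anchor_gt[OF _ 3 X(2)] x by blast
        then show ?thesis using dg[of X] tip by (simp add: of_bool_def split: if_splits)
      qed
    qed
    then have "anchored M (nV M) (tipdeg M)" using x unfolding anchored_def by auto
    then show ?thesis using wfM gM by (simp add: admissible_def)
  qed
  moreover have "net_size M < net_size N"
  proof -
    have "card (nE N - {e}) < card (nE N)" using eN by (intro psubset_card_mono) auto
    then show ?thesis unfolding net_size_def tip by simp
  qed
  ultimately obtain g where g: "flow M g" using smaller by blast
  let ?f = "g(e := s)"
  have "3 dvd (\<Sum>e\<in>nE N. ?f e * inc N e w) - bd N w" if w: "w \<in> nV N" for w
  proof -
    have "(\<Sum>e\<in>nE N. ?f e * inc N e w) = s * inc N e w + (\<Sum>e'\<in>nE N - {e}. ?f e' * inc N e' w)"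
      using sum.remove[OF finE eN(1), of "\<lambda>e. ?f e * inc N e w"] by simp
    also have "(\<Sum>e'\<in>nE N - {e}. ?f e' * inc N e' w) = (\<Sum>e'\<in>nE N - {e}. g e' * inc N e' w)"
      by (intro sum.cong) auto
    finally have eq: "(\<Sum>e\<in>nE N. ?f e * inc N e w) = s * inc N e w + (\<Sum>e'\<in>nE N - {e}. g e' * inc N e' w)" .
    have "bd N w = bd M w + s * inc N e w" using eN u by (auto simp: inc_def bdM)
    moreover have "3 dvd (\<Sum>e'\<in>nE N - {e}. g e' * inc N e' w) - bd M w"
      using g w by (simp add: flow_def inc_def)
    ultimately show ?thesis unfolding eq by (simp add: diff_diff_eq2)
  qed
  then have "flow N ?f" using g s by (auto simp: flow_def)
  then show False using noflow by blast
qed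

end

section \<open>Deleting a vertex of degree five\<close>

context minimal_net_at
begin

text \<open>All tip edges at \<open>v\<close> enter it. With the remaining edges also oriented
  towards \<open>v\<close> its balance is -5, which is 1 modulo 3, as required. Then
  \<open>v\<close> can be deleted: each neighbour loses one edge and has its boundary lowered by 1,
  as \<open>nb\<close> permits.\<close>

lemma no_absorbing_vertex:
  assumes v5: "dgr N {v} = 5" "3 dvd bet N {v} - 1" and po: "pout N v = 0" and pi: "1 \<le> pin N v"
    and nb: "\<And>e. e \<in> star \<Longrightarrow> fine (dgr N {head N e} - 1) (bet N {head N e} - 1)"
    and an: "tipdeg N \<le> 7 \<and> (tipdeg N = 7 \<and> pin N v = 1 \<longrightarrow> (\<exists>t\<in>nV N - {v}. \<forall>e\<in>star. head N e \<noteq> t)) \<or>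
      x \<in> nV N \<and> x \<noteq> v \<and> (\<forall>X\<subseteq>nV N. x \<in> X \<longrightarrow> tipdeg N \<le> dgr N X + 1)"
  shows False
proof -
  define M where "M = N\<lparr>nV := nV N - {v}, nE := rest, bd := (\<lambda>u. bd N u - (\<Sum>e\<in>star. of_bool (head N e = u)))\<rparr>"
  have sel [simp]: "nV M = nV N - {v}" "nE M = rest" "tail M = tail N" "head M = head N" "pin M = pin N" "pout M = pout N"
    and bdM: "bd M = (\<lambda>u. bd N u - (\<Sum>e\<in>star. of_bool (head N e = u)))" by (simp_all add: M_def)
  define k where "k X = (\<Sum>e\<in>star. of_bool (head N e \<in> X) :: nat)" for X
  have cF: "card star + pin N v = 5" using dgr_v v5 po by simp
  have kle: "k X \<le> 4" for X
  proof -
    have "k X \<le> (\<Sum>e\<in>star. 1)" unfolding k_def by (intro sum_mono) auto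
    then show ?thesis using cF pi by simp
  qed
  have dg: "dgr M X + k X = dgr N X" if "X \<subseteq> nV N - {v}" for X
    unfolding dgr_off[OF that] by (simp add: dgr_def k_def)
  have ins: "dgr N (insert v X) + 2 * k X = dgr N X + 5" if "X \<subseteq> nV N - {v}" for X
    using dgr_insert_v[OF that] v5 by (simp add: k_def)
  have ksum: "(\<Sum>u\<in>X. \<Sum>e\<in>star. of_bool (head N e = u)) = int (k X)" if "finite X" for X
  proof -
    have "(\<Sum>u\<in>X. \<Sum>e\<in>star. of_bool (head N e = u) :: int) = (\<Sum>e\<in>star. \<Sum>u\<in>X. of_bool (head N e = u))"
      by (rule sum.swap)
    also have "\<dots> = (\<Sum>e\<in>star. of_bool (head N e \<in> X))"
      using sum_of_bool_pt[OF that, where 'c=int] by (simp add: eq_commute)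
    also have "\<dots> = int (k X)" by (simp add: k_def)
    finally show ?thesis .
  qed
  have bt: "bet M X = bet N X - int (k X)" if "finite X" for X
    using ksum[OF that] by (simp add: bet_def bdM sum_subtractf sum.distrib)
  have bdv: "3 dvd - int (card star) - bd N v"
  proof -
    have "bet N {v} = bd N v - int (pin N v)" using po by (simp add: bet_def)
    moreover have "int (card star) = 5 - int (pin N v)" using cF by linarith
    ultimately have "- int (card star) - bd N v = - (bet N {v} - 1) - 6" by linarith
    then show ?thesis using v5(2) by presburger
  qed
  have wfM: "wf_net M"
  proof -
    have "k (nV N - {v}) = card star"
      unfolding k_def using starD by (subst sum.cong[of star star _ "\<lambda>_. 1"]) auto
    then have "(\<Sum>u\<in>nV N - {v}. bd M u) = (\<Sum>u\<in>nV N. bd N u) + (- int (card star) - bd N v)"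
      using ksum[of "nV N - {v}"] by (simp add: bdM sum_subtractf sum_bd_remove)
    then have "3 dvd (\<Sum>u\<in>nV N - {v}. bd M u)" using bdv dvd_sum_bd by simp
    then show ?thesis unfolding wf_net_def using restD ends_in by auto
  qed
  have tip: "tipdeg M + pin N v = tipdeg N"
    using v po by (simp add: tipdeg_def sum.remove[of "nV N" v])
  \<comment> \<open>The new degree is the degree of \<open>X\<close> minus \<open>k\<close>, and
    also that of \<open>insert v X\<close> minus \<open>5 - k\<close>. Both degrees are at least 8,
    and one of \<open>k\<close> and \<open>5 - k\<close> is at most 2.\<close>
  have big: "6 \<le> dgr M X" if X: "X \<subset> nV N - {v}" "2 \<le> card X" for X
  proof -
    have sub: "X \<subseteq> nV N - {v}" using X by auto
    have fin: "finite X" using sub finX by blast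
    have "8 \<le> dgr N X" using X v by (intro dgr_ge_8) auto
    moreover have "v \<notin> X" using sub by blast
    then have "card (insert v X) = Suc (card X)" using fin by simp
    then have "8 \<le> dgr N (insert v X)" using X v by (intro dgr_ge_8) auto
    ultimately show ?thesis using dg[OF sub] ins[OF sub] kle[of X] by presburger
  qed
  have single: "X = {y} \<or> X \<subset> nV N \<and> 2 \<le> card X" if "X \<subseteq> nV N - {v}" "y \<in> X" for X y
    using single_or_dgr_ge_8[of X y] that v by auto
  have k1: "k {y} = of_bool (\<exists>e\<in>star. head N e = y)" for y
  proof (cases "\<exists>e\<in>star. head N e = y")
    case True
    then obtain e where e: "e \<in> star" "head N e = y" by blast
    have "k {y} = (\<Sum>e'\<in>star. of_bool (e' = e))"
      unfolding k_def using star_head_inj e by (intro sum.cong) (auto simp: of_bool_def)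
    then show ?thesis using True e sum_of_bool_pt[OF fin_star, of e, where 'c=nat] by simp
  next
    case False
    then show ?thesis by (auto simp: k_def)
  qed
  have gM: "good M" unfolding good_def
  proof (intro allI impI)
    fix X assume "X \<subseteq> nV M" "X \<noteq> {} \<and> X \<noteq> nV M"
    then have X: "X \<subseteq> nV N - {v}" "X \<noteq> {}" "X \<noteq> nV N - {v}" by auto
    obtain y where y: "y \<in> X" using X by blast
    from single[OF X(1) y] show "fine (dgr M X) (bet M X)"
    proof
      assume X1: "X = {y}"
      show ?thesis
      proof (cases "\<exists>e\<in>star. head N e = y")
        case True
        then have "dgr M X = dgr N {y} - 1" "bet M X = bet N {y} - 1"
          using dg[OF X(1)] bt[of X] k1[of y] X1 by auto
        then show ?thesis using nb True by auto
      next
        case False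
        then have "dgr M X = dgr N {y}" "bet M X = bet N {y}"
          using dg[OF X(1)] bt[of X] k1[of y] X1 by auto
        then show ?thesis using fine_single[of y] X(1) y by auto
      qed
    next
      assume "X \<subset> nV N \<and> 2 \<le> card X"
      then have "6 \<le> dgr M X" using X by (intro big) auto
      then show ?thesis by (rule fine_ge_6)
    qed
  qed
  have "admissible M"
    using an
  proof
    assume small: "tipdeg N \<le> 7 \<and> (tipdeg N = 7 \<and> pin N v = 1 \<longrightarrow> (\<exists>t\<in>nV N - {v}. \<forall>e\<in>star. head N e \<noteq> t))"
    show ?thesis
    proof (rule admissible_small[OF wfM gM])
      show "nV M \<noteq> {}" using not_single[of v] v by auto
      show "tipdeg M \<le> 7" using small tip by simp
      show "6 \<le> dgr M X" if "X \<subset> nV M" "2 \<le> card X" for X using big[of X] that by simp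
      \<comment> \<open>This happens only for tip degree 7 with a single tip edge at
        \<open>v\<close>; a vertex not adjacent to \<open>v\<close> then keeps its degree.\<close>
      assume "tipdeg M = 6"
      then have "tipdeg N = 7 \<and> pin N v = 1" using tip small pi by linarith
      then obtain t where t: "t \<in> nV N - {v}" "\<forall>e\<in>star. head N e \<noteq> t" using small by blast
      then have "dgr M {t} = dgr N {t}" using dg[of "{t}"] k1[of t] by auto
      then show "\<exists>t\<in>nV M. 5 \<le> dgr M {t}" using t dgr_single_ge_5[of t] by (intro bexI[of _ t]) auto
    next
      assume "tipdeg M = 7"
      then show "\<exists>t\<in>nV M. \<exists>t'\<in>nV M. t \<noteq> t' \<and> 5 \<le> dgr M {t} \<and> 5 \<le> dgr M {t'}"
        using tip small pi by linarith
    qed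
  next
    assume "x \<in> nV N \<and> x \<noteq> v \<and> (\<forall>X\<subseteq>nV N. x \<in> X \<longrightarrow> tipdeg N \<le> dgr N X + 1)"
    then have x: "x \<in> nV N" "x \<noteq> v" "\<forall>X\<subseteq>nV N. x \<in> X \<longrightarrow> tipdeg N \<le> dgr N X + 1" by blast+
    have "tipdeg M \<le> dgr M X + 1" if X: "X \<subseteq> nV N - {v}" "x \<in> X" for X
    proof (cases "X = nV N - {v}")
      case True
      then show ?thesis using dgr_nV[OF wfM] by simp
    next
      case False
      from single[OF X] show ?thesis
      proof
        assume "X = {x}"
        then have "tipdeg N \<le> dgr N X + 1" "k X \<le> 1" using x k1[of x] by auto
        then show ?thesis using dg[OF X(1)] tip pi by linarith
      next
        assume nt: "X \<subset> nV N \<and> 2 \<le> card X"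
        have fin: "finite X" using X finX by blast
        have "tipdeg N < dgr N X" using dgr_anchor_gt[OF x(3) _ _ X(2)] nt by blast
        moreover have "tipdeg N < dgr N (insert v X)"
        proof (rule dgr_anchor_gt[OF x(3)])
          show "insert v X \<subset> nV N" using X(1) False v by auto
          have "v \<notin> X" using X(1) by blast
          then have "card (insert v X) = Suc (card X)" using fin by simp
          then show "2 \<le> card (insert v X)" using nt by simp
        qed (use X in simp)
        \<comment> \<open>Again one of the losses \<open>k\<close> and \<open>5 - k\<close> is at
          most 2, while both degrees exceed the old tip degree.\<close>
        ultimately show ?thesis using dg[OF X(1)] ins[OF X(1)] kle[of X] tip pi by presburger
      qed
    qed
    then have "anchored M (nV M) (tipdeg M)" using x(1,2) by (auto simp: anchored_def)
    then show ?thesis using wfM gM by (simp add: admissible_def)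
  qed
  moreover have "net_size M < net_size N"
  proof -
    have "card (nV N - {v}) < card (nV N)" using v by (intro psubset_card_mono) auto
    moreover have "card rest \<le> card (nE N)" by (intro card_mono) (auto simp: rest_def)
    ultimately show ?thesis using tip by (simp add: net_size_def)
  qed
  ultimately obtain g where g: "flow M g" using smaller by blast
  define f where "f e = (if e \<in> rest then g e else -1)" for e
  have fF: "f e = -1" if "e \<in> star" for e using starD[OF that] by (simp add: f_def)
  show False
  proof (rule no_flow_at[of f])
    fix e assume "e \<in> rest \<union> star"
    then show "f e = 1 \<or> f e = -1" using g by (auto simp: flow_def f_def)
  next
    fix u assume u: "u \<in> nV N - {v}"
    have "(\<Sum>e\<in>rest. f e * inc N e u) = (\<Sum>e\<in>rest. g e * inc M e u)"
      by (intro sum.cong) (auto simp: f_def inc_def)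
    moreover have "(\<Sum>e\<in>star. f e * of_bool (head N e = u)) = - (\<Sum>e\<in>star. of_bool (head N e = u))"
      unfolding sum_negf[symmetric] using fF by (intro sum.cong) auto
    moreover have "3 dvd (\<Sum>e\<in>rest. g e * inc M e u) - bd M u" using g u by (simp add: flow_def)
    ultimately show "3 dvd (\<Sum>e\<in>rest. f e * inc N e u) - (\<Sum>e\<in>star. f e * of_bool (head N e = u)) - bd N u"
      by (simp add: bdM algebra_simps del: sum_of_bool_eq)
  next
    have "(\<Sum>e\<in>star. f e) = - int (card star)" using fF by simp
    then show "3 dvd (\<Sum>e\<in>star. f e) - bd N v" using bdv by simp
  qed
qed

text \<open>\<open>v\<close> is resistant, and so is every neighbour, as otherwise the edge to it
  could be oriented away from \<open>v\<close> and deleted. For tip degree above 7 the anchor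
  \<open>x\<close> is exempt; its degree is at least 7, so it differs from \<open>v\<close> and may
  lose an edge anyway.\<close>

lemma no_pin_at:
  assumes pi: "1 \<le> pin N v"
    and max: "tipdeg N = 7 \<Longrightarrow> 2 \<le> pin N v + pout N v \<or> (\<forall>w\<in>nV N. pin N w + pout N w \<le> 1)"
  shows False
proof -
  have rv: "resistant N v" by (rule resistant_if_pin[OF v pi])
  then have d56: "dgr N {v} = 5 \<or> dgr N {v} = 6" by (auto simp: resistant_def)
  have po: "pout N v = 0" by (rule pout_zero_if_pin[OF v pi])
  obtain x where x: "tipdeg N \<le> 7 \<or> x \<in> nV N \<and> x \<noteq> v \<and> 7 \<le> dgr N {x} \<and> (\<forall>X\<subseteq>nV N. x \<in> X \<longrightarrow> tipdeg N \<le> dgr N X + 1)"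
  proof (cases "tipdeg N \<le> 7")
    case False
    then have "anchored N (nV N) (tipdeg N)" using anch by (auto simp: twin_anchored_def)
    then obtain x where x: "x \<in> nV N" "\<forall>X\<subseteq>nV N. x \<in> X \<longrightarrow> tipdeg N \<le> dgr N X + 1"
      by (auto simp: anchored_def)
    have "tipdeg N \<le> dgr N {x} + 1" using x by auto
    then have "7 \<le> dgr N {x}" using False by simp
    moreover from this have "x \<noteq> v" using d56 by auto
    ultimately show ?thesis using x that by blast
  qed (use that in blast)
  have an: "tipdeg N \<le> 7 \<and> 3 \<le> card star \<or>
      x \<in> nV N \<and> x \<noteq> head N e \<and> x \<noteq> v \<and> (\<forall>X\<subseteq>nV N. x \<in> X \<longrightarrow> tipdeg N \<le> dgr N X + 1)"
    if "tipdeg N \<le> 7 \<or> head N e \<noteq> x" for e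
    using x that card_star_ge_3[OF d56] by metis
  have nb: "resistant N (head N e)" if e: "e \<in> star" "tipdeg N \<le> 7 \<or> head N e \<noteq> x" for e
  proof (rule ccontr)
    assume nr: "\<not> resistant N (head N e)"
    have "head N e \<in> nV N" using starD[OF e(1)] by simp
    then have "fine (dgr N {head N e} - 1) (bet N {head N e} + 1)"
      using not_resistant_fine[OF nr] dgr_single_ge_5 fine_single by blast
    then show False
      using edge_delete[OF e(1) refl, of 1 False x] resistant_fine[OF rv] an[OF e(2)] by simp
  qed
  show False
  proof (cases "dgr N {v} = 6")
    case True
    have "3 \<le> card star" using card_star_ge_3[OF d56] card_star_ge_3_anchored[OF True] x by blast
    then obtain e where e: "e \<in> star" "head N e \<noteq> x" using obtain_heads by blast
    have "3 dvd bet N {v} + 1" using rv True by (simp add: resistant_def)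
    then have "\<not> 3 dvd bet N {v} + 3" by presburger
    \<comment> \<open>Orienting the edge towards \<open>v\<close> and reversing a tip edge shift the
      boundary by 1 and 2, so it remains -1 modulo 3 while the degree falls to 5.\<close>
    then have "fine (dgr N {v} - 1) (bet N {v} - (-1) + 2 * of_bool True)" using True by (simp add: fine_def)
    moreover have "fine (dgr N {head N e} - 1) (bet N {head N e} + (-1))"
      using resistant_fine[OF nb[OF e(1)]] e(2) by simp
    ultimately show False
      using edge_delete[OF e(1) refl, of "-1" True x] pi an[of e] e(2) by blast
  next
    case False
    then have v5: "dgr N {v} = 5" "3 dvd bet N {v} - 1" using rv by (auto simp: resistant_def)
    show False
    proof (rule no_absorbing_vertex[OF v5 po pi])
      fix e assume e: "e \<in> star"
      show "fine (dgr N {head N e} - 1) (bet N {head N e} - 1)"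
      proof (cases "tipdeg N \<le> 7 \<or> head N e \<noteq> x")
        case True
        then show ?thesis using resistant_fine[OF nb[OF e]] by blast
      next
        case False
        then have "7 \<le> dgr N {head N e}" using x by blast
        then show ?thesis by (intro fine_ge_6) simp
      qed
    next
      \<comment> \<open>By \<open>max\<close> no vertex has more than one tip edge, so tip degree 7
        needs seven vertices, while \<open>v\<close> has only four neighbours.\<close>
      have "\<exists>t\<in>nV N - {v}. \<forall>e\<in>star. head N e \<noteq> t" if t7: "tipdeg N = 7" "pin N v = 1"
      proof (rule ccontr)
        assume "\<not> ?thesis"
        then have ex: "\<exists>e\<in>star. head N e = t" if "t \<in> nV N - {v}" for t using that by blast
        have "nV N \<subseteq> insert v (head N ` star)"
        proof
          fix t assume "t \<in> nV N"
          then show "t \<in> insert v (head N ` star)" using ex[of t] by (cases "t = v") auto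
        qed
        then have "card (nV N) \<le> card (insert v (head N ` star))" by (intro card_mono) auto
        also have "\<dots> \<le> Suc (card star)"
          by (rule order_trans[OF card_insert_le_m1[of "Suc (card star)"]]) (auto intro: card_image_le)
        also have "\<dots> \<le> 5" using dgr_v v5 t7 po by simp
        finally have "card (nV N) \<le> 5" .
        moreover have "tipdeg N \<le> (\<Sum>w\<in>nV N. 1)"
          unfolding tipdeg_def using max[OF t7(1)] t7 po by (intro sum_mono) auto
        ultimately show False using t7 by simp
      qed
      then show "tipdeg N \<le> 7 \<and> (tipdeg N = 7 \<and> pin N v = 1 \<longrightarrow> (\<exists>t\<in>nV N - {v}. \<forall>e\<in>star. head N e \<noteq> t)) \<or>
        x \<in> nV N \<and> x \<noteq> v \<and> (\<forall>X\<subseteq>nV N. x \<in> X \<longrightarrow> tipdeg N \<le> dgr N X + 1)"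
        using x by blast
    qed
  qed
qed

end

section \<open>The contradiction and the induction\<close>

context minimal_net
begin

lemma no_pin:
  assumes "w \<in> nV N" "1 \<le> pin N w"
    "tipdeg N = 7 \<Longrightarrow> 2 \<le> pin N w + pout N w \<or> (\<forall>w\<in>nV N. pin N w + pout N w \<le> 1)"
  shows False
  using minimal_net_at.no_pin_at[OF minimal_net_at_orient_out[OF assms(1)]] assms
  by (simp add: orient_out_def tipdeg_def)

text \<open>A vertex with two tip edges is chosen if there is one; otherwise every vertex has at
  most one and any vertex with a tip edge will do. If its tip edges all leave it, the mirrored net
  is used.\<close>

lemma contradiction: False
proof -
  obtain w where w: "w \<in> nV N" "1 \<le> pin N w + pout N w"
    "tipdeg N = 7 \<Longrightarrow> 2 \<le> pin N w + pout N w \<or> (\<forall>w\<in>nV N. pin N w + pout N w \<le> 1)"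
  proof (cases "\<exists>w\<in>nV N. 2 \<le> pin N w + pout N w")
    case True
    then obtain w where "w \<in> nV N" "2 \<le> pin N w + pout N w" by blast
    then show ?thesis using that[of w] by simp
  next
    case False
    have "\<exists>w\<in>nV N. pin N w + pout N w \<noteq> 0" using tipdeg_pos unfolding tipdeg_def
      by (metis (no_types, lifting) less_numeral_extra(3) sum.neutral)
    moreover have "\<forall>w\<in>nV N. pin N w + pout N w \<le> 1" using False by (auto simp: not_le)
    ultimately show ?thesis using that by (metis One_nat_def less_one not_le)
  qed
  show False
  proof (cases "1 \<le> pin N w")
    case True
    then show False using no_pin[OF w(1)] w(3) by blast
  next
    case False
    then have po: "1 \<le> pout N w" using w(2) by simp
    have "pin (mirror N) = pout N" "pout (mirror N) = pin N" "nV (mirror N) = nV N"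
      "tipdeg (mirror N) = tipdeg N" by (simp_all add: mirror_def tipdeg_def add.commute)
    then show False
      using minimal_net.no_pin[OF minimal_mirror, of w] w po by (simp add: add.commute)
  qed
qed

end

theorem admissible_flow:
  fixes N :: "('v, 'e) net"
  assumes "admissible N"
  shows "\<exists>f. flow N f"
  using assms
proof (induction "net_size N" arbitrary: N rule: less_induct)
  case less
  show ?case
  proof (rule ccontr)
    assume "\<nexists>f. flow N f"
    then interpret minimal_net N
      using less by unfold_locales auto
    show False by (rule contradiction)
  qed
qed

subsection \<open>From canvases to nets\<close>

lemma Z3_three: "(3::3) = 0"
  by simp

lemma Z3_one_neq: "(1::3) \<noteq> 0" "(2::3) \<noteq> 0"
  by simp_all

lemma of_int_Z3_eq_0_iff: "(of_int n :: 3) = 0 \<longleftrightarrow> 3 dvd n"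
proof -
  have "(of_int n :: 3) = of_int (3 * (n div 3) + n mod 3)" by simp
  also have "\<dots> = of_int (n mod 3)" by (simp only: of_int_add of_int_mult of_int_numeral Z3_three) simp
  finally have *: "(of_int n :: 3) = of_int (n mod 3)" .
  have "n mod 3 = 0 \<or> n mod 3 = 1 \<or> n mod 3 = 2" by presburger
  then show ?thesis using Z3_one_neq unfolding * dvd_eq_mod_eq_0 by auto
qed

lemma of_int_Z3_surj: "\<exists>n. of_int n = (x::3)"
proof -
  have "{0, 1, 2} = (UNIV :: 3 set)" by (rule card_seteq) simp_all
  then have "x \<in> {0, 1, 2}" by simp
  then have "x = of_int 0 \<or> x = of_int 1 \<or> x = of_int 2" by simp
  then show ?thesis by metis
qed

lemma sum_components:
  assumes "graph G" "Z3_boundary G \<beta>"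
  shows "(\<Sum>v\<in>verts G. \<beta> v) = 0"
proof -
  let ?c = "\<lambda>u. {v \<in> verts G. (u, v) \<in> (adjacency G)\<^sup>*}"
  have sym: "sym ((adjacency G)\<^sup>*)"
    by (intro sym_rtrancl) (auto simp: sym_def adjacency_def insert_commute)
  have cl: "?c u = ?c v" if "(u, v) \<in> (adjacency G)\<^sup>*" for u v
    using that sym by (auto dest: symD intro: rtrancl_trans)
  have comp: "components G = ?c ` verts G" by (auto simp: components_def)
  have "\<Union> (components G) = verts G" by (auto simp: comp)
  moreover have "(\<Sum>v\<in>\<Union> (components G). \<beta> v) = (\<Sum>C\<in>components G. \<Sum>v\<in>C. \<beta> v)"
  proof (rule sum.Union_disjoint[unfolded comp_def])
    show "\<forall>C\<in>components G. finite C" using assms by (auto simp: comp graph_def)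
    show "\<forall>A\<in>components G. \<forall>B\<in>components G. A \<noteq> B \<longrightarrow> A \<inter> B = {}"
    proof (intro ballI impI)
      fix A B assume "A \<in> components G" "B \<in> components G" "A \<noteq> B"
      then obtain u w where uw: "A = ?c u" "B = ?c w" by (auto simp: comp)
      show "A \<inter> B = {}"
      proof (rule ccontr)
        assume "A \<inter> B \<noteq> {}"
        then obtain y where "(u, y) \<in> (adjacency G)\<^sup>*" "(w, y) \<in> (adjacency G)\<^sup>*" using uw by auto
        from this[THEN cl] show False using uw \<open>A \<noteq> B\<close> by simp
      qed
    qed
  qed
  ultimately show ?thesis using assms by (simp add: Z3_boundary_def)
qed

lemma card_Int_pair: "a \<noteq> b \<Longrightarrow> card ({a, b} \<inter> X) = 1 \<longleftrightarrow> (a \<in> X) \<noteq> (b \<in> X)"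
  by (cases "a \<in> X"; cases "b \<in> X") auto

lemma card_filter: "finite E \<Longrightarrow> card {e \<in> E. P e} = (\<Sum>e\<in>E. of_bool (P e))"
  by (simp add: Int_def)

locale preflow_net =
  fixes G :: "('v, 'e) mgraph" and \<beta> :: "'v \<Rightarrow> 3" and z :: 'v and \<psi> :: "'e \<Rightarrow> 'v \<times> 'v"
  assumes canvas: "canvas G \<beta> z" and preflow: "tip_preflow G \<beta> z \<psi>"
begin

abbreviation tip_edges where "tip_edges \<equiv> incident_edges G z"

text \<open>An arbitrary reference direction; the signs of the flow decide the actual
  orientation.\<close>

definition ref :: "'e \<Rightarrow> 'v \<times> 'v" where
  "ref e = (SOME p. ends G e = {fst p, snd p})"

definition into :: "'v \<Rightarrow> nat" where
  "into v = card {e \<in> tip_edges. fst (\<psi> e) = z \<and> snd (\<psi> e) = v}"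

definition outof :: "'v \<Rightarrow> nat" where
  "outof v = card {e \<in> tip_edges. fst (\<psi> e) = v \<and> snd (\<psi> e) = z}"

text \<open>An integer representative of the boundary left for the remaining edges: a tip edge into
  \<open>v\<close> contributes -1 to the balance of \<open>v\<close>, hence is added back.\<close>

definition bdz :: "'v \<Rightarrow> int" where
  "bdz v = (SOME n. of_int n = \<beta> v + of_nat (into v) - of_nat (outof v))"

definition tip_net where
  "tip_net = \<lparr>nV = verts G - {z}, nE = edges G - tip_edges, tail = (\<lambda>e. fst (ref e)), head = (\<lambda>e. snd (ref e)),
    pin = into, pout = outof, bd = bdz\<rparr>"

lemma sel [simp]: "nV tip_net = verts G - {z}" "nE tip_net = edges G - tip_edges" "tail tip_net e = fst (ref e)"
  "head tip_net e = snd (ref e)" "pin tip_net = into" "pout tip_net = outof" "bd tip_net = bdz"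
  by (simp_all add: tip_net_def)

lemma fin [simp]: "finite (verts G)" "finite (edges G)" "finite tip_edges"
  using canvas by (auto simp: canvas_def graph_def incident_edges_def)

lemma of_int_bdz: "of_int (bdz v) = \<beta> v + of_nat (into v) - of_nat (outof v)"
  unfolding bdz_def using of_int_Z3_surj by (rule someI_ex)

lemma ends_props:
  assumes "e \<in> edges G"
  shows "ends G e = {fst (ref e), snd (ref e)}" "fst (ref e) \<noteq> snd (ref e)"
    "fst (ref e) \<in> verts G" "snd (ref e) \<in> verts G"
proof -
  have c: "card (ends G e) = 2" "ends G e \<subseteq> verts G"
    using assms canvas by (auto simp: canvas_def graph_def)
  then obtain a b where "ends G e = {a, b}" "a \<noteq> b" by (auto simp: card_2_iff)
  then have "ends G e = {fst (a, b), snd (a, b)}" by simp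
  then show eq: "ends G e = {fst (ref e), snd (ref e)}"
    unfolding ref_def by (rule someI)
  show "fst (ref e) \<noteq> snd (ref e)" using c unfolding eq by auto
  show "fst (ref e) \<in> verts G" "snd (ref e) \<in> verts G" using c unfolding eq by auto
qed

lemma tip_edges_props:
  assumes "e \<in> tip_edges"
  shows "e \<in> edges G" "\<exists>w\<in>verts G - {z}. ends G e = {z, w} \<and> (\<psi> e = (z, w) \<or> \<psi> e = (w, z))"
proof -
  show e: "e \<in> edges G" using assms by (simp add: incident_edges_def)
  have "z \<in> ends G e" using assms by (simp add: incident_edges_def)
  then have zr: "z = fst (ref e) \<or> z = snd (ref e)" using ends_props(1)[OF e] by blast
  define w where "w = (if z = fst (ref e) then snd (ref e) else fst (ref e))"
  have w: "ends G e = {z, w}" "w \<noteq> z" "w \<in> verts G"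
    using ends_props[OF e] zr by (auto simp: w_def)
  have "{fst (\<psi> e), snd (\<psi> e)} = ends G e"
    using preflow assms by (simp add: tip_preflow_def orientation_on_def)
  then have "fst (\<psi> e) = z \<and> snd (\<psi> e) = w \<or> fst (\<psi> e) = w \<and> snd (\<psi> e) = z"
    unfolding w(1) by (simp add: doubleton_eq_iff)
  then have "\<psi> e = (z, w) \<or> \<psi> e = (w, z)" by (simp add: prod_eq_iff)
  then show "\<exists>w\<in>verts G - {z}. ends G e = {z, w} \<and> (\<psi> e = (z, w) \<or> \<psi> e = (w, z))"
    using w by (intro bexI[of _ w]) simp_all
qed

lemma sum_tip:
  assumes X: "X \<subseteq> verts G - {z}"
  shows "(\<Sum>v\<in>X. into v) = (\<Sum>e\<in>tip_edges. of_bool (fst (\<psi> e) = z \<and> snd (\<psi> e) \<in> X))"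
    and "(\<Sum>v\<in>X. outof v) = (\<Sum>e\<in>tip_edges. of_bool (fst (\<psi> e) \<in> X \<and> snd (\<psi> e) = z))"
    and "(\<Sum>v\<in>X. into v + outof v) = (\<Sum>e\<in>tip_edges. of_bool (card (ends G e \<inter> X) = 1))"
proof -
  have finX: "finite X" using X finite_subset by fastforce
  have pt: "(\<Sum>v\<in>X. of_bool (P \<and> a = v)) = (of_bool (P \<and> a \<in> X) :: nat)"
    "(\<Sum>v\<in>X. of_bool (a = v \<and> P)) = (of_bool (a \<in> X \<and> P) :: nat)" for a P
    using finX by (auto simp: of_bool_def sum.delta')
  show 1: "(\<Sum>v\<in>X. into v) = (\<Sum>e\<in>tip_edges. of_bool (fst (\<psi> e) = z \<and> snd (\<psi> e) \<in> X))"
    unfolding into_def card_filter[OF fin(3)] by (subst sum.swap) (simp only: pt)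
  show 2: "(\<Sum>v\<in>X. outof v) = (\<Sum>e\<in>tip_edges. of_bool (fst (\<psi> e) \<in> X \<and> snd (\<psi> e) = z))"
    unfolding outof_def card_filter[OF fin(3)] by (subst sum.swap) (simp only: pt)
  have "of_bool (fst (\<psi> e) = z \<and> snd (\<psi> e) \<in> X) + of_bool (fst (\<psi> e) \<in> X \<and> snd (\<psi> e) = z)
      = (of_bool (card (ends G e \<inter> X) = 1) :: nat)" if e: "e \<in> tip_edges" for e
  proof -
    obtain w where w: "w \<in> verts G - {z}" "ends G e = {z, w}" "\<psi> e = (z, w) \<or> \<psi> e = (w, z)"
      using tip_edges_props(2)[OF e] by blast
    have "z \<notin> X" "z \<noteq> w" using X w by auto
    then have "card (ends G e \<inter> X) = 1 \<longleftrightarrow> w \<in> X" using card_Int_pair[of z w X] unfolding w(2) by simp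
    with w(3) show ?thesis using \<open>z \<notin> X\<close> \<open>z \<noteq> w\<close> by (elim disjE) simp_all
  qed
  then show "(\<Sum>v\<in>X. into v + outof v) = (\<Sum>e\<in>tip_edges. of_bool (card (ends G e \<inter> X) = 1))"
    unfolding sum.distrib 1 2 unfolding sum.distrib[symmetric] by (intro sum.cong refl)
qed

lemma dgr_tip_net: "X \<subseteq> verts G - {z} \<Longrightarrow> dgr tip_net X = deg G X"
proof -
  assume X: "X \<subseteq> verts G - {z}"
  have "deg G X = (\<Sum>e\<in>edges G. of_bool (card (ends G e \<inter> X) = 1))"
    by (simp only: deg_def card_filter[OF fin(2)])
  also have "\<dots> = (\<Sum>e\<in>edges G - tip_edges. of_bool (card (ends G e \<inter> X) = 1)) + (\<Sum>e\<in>tip_edges. of_bool (card (ends G e \<inter> X) = 1))"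
    by (intro sum.subset_diff) (auto simp: incident_edges_def)
  also have "(\<Sum>e\<in>edges G - tip_edges. of_bool (card (ends G e \<inter> X) = 1) :: nat)
     = (\<Sum>e\<in>edges G - tip_edges. of_bool ((fst (ref e) \<in> X) \<noteq> (snd (ref e) \<in> X)))"
  proof (rule sum.cong[OF refl])
    fix e assume "e \<in> edges G - tip_edges"
    then have e: "e \<in> edges G" by simp
    show "of_bool (card (ends G e \<inter> X) = 1) = (of_bool ((fst (ref e) \<in> X) \<noteq> (snd (ref e) \<in> X)) :: nat)"
      unfolding ends_props(1)[OF e] card_Int_pair[OF ends_props(2)[OF e]] ..
  qed
  finally show ?thesis using sum_tip(3)[OF X] by (simp add: dgr_def)
qed

lemma of_int_bet: "X \<subseteq> verts G - {z} \<Longrightarrow> of_int (bet tip_net X) = (\<Sum>v\<in>X. \<beta> v)"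
  by (simp add: bet_def of_int_bdz)

lemma tipdeg_tip_net: "tipdeg tip_net = vdeg G z"
proof -
  have "(\<Sum>e\<in>tip_edges. of_bool (card (ends G e \<inter> (verts G - {z})) = 1) :: nat) = (\<Sum>e\<in>tip_edges. 1)"
  proof (rule sum.cong[OF refl])
    fix e assume "e \<in> tip_edges"
    then obtain w where w: "w \<in> verts G - {z}" "ends G e = {z, w}" using tip_edges_props(2) by blast
    then have "z \<noteq> w" by auto
    then show "of_bool (card (ends G e \<inter> (verts G - {z})) = 1) = (1::nat)"
      unfolding w(2) card_Int_pair[OF \<open>z \<noteq> w\<close>] using w by simp
  qed
  then show ?thesis using sum_tip(3)[of "verts G - {z}"] by (simp add: tipdeg_def vdeg_def)
qed

lemma outdeg_z: "outdeg tip_edges \<psi> z = (\<Sum>v\<in>verts G - {z}. into v)"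
  and indeg_z: "indeg tip_edges \<psi> z = (\<Sum>v\<in>verts G - {z}. outof v)"
proof -
  have *: "fst (\<psi> e) = z \<longleftrightarrow> fst (\<psi> e) = z \<and> snd (\<psi> e) \<in> verts G - {z}"
    "snd (\<psi> e) = z \<longleftrightarrow> fst (\<psi> e) \<in> verts G - {z} \<and> snd (\<psi> e) = z" if e: "e \<in> tip_edges" for e
  proof -
    obtain w where w: "w \<in> verts G - {z}" "\<psi> e = (z, w) \<or> \<psi> e = (w, z)"
      using tip_edges_props(2)[OF e] by blast
    from w(2) show "fst (\<psi> e) = z \<longleftrightarrow> fst (\<psi> e) = z \<and> snd (\<psi> e) \<in> verts G - {z}"
      "snd (\<psi> e) = z \<longleftrightarrow> fst (\<psi> e) \<in> verts G - {z} \<and> snd (\<psi> e) = z"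
      using w(1) by (elim disjE; simp)+
  qed
  show "outdeg tip_edges \<psi> z = (\<Sum>v\<in>verts G - {z}. into v)"
    unfolding outdeg_def card_filter[OF fin(3)] sum_tip(1)[OF subset_refl]
    by (intro sum.cong refl arg_cong[where f = of_bool] *(1))
  show "indeg tip_edges \<psi> z = (\<Sum>v\<in>verts G - {z}. outof v)"
    unfolding indeg_def card_filter[OF fin(3)] sum_tip(2)[OF subset_refl]
    by (intro sum.cong refl arg_cong[where f = of_bool] *(2))
qed

text \<open>The tip edges add \<open>outdeg\<close> minus \<open>indeg\<close> at \<open>z\<close>
  to the total boundary. For a preflow this is \<open>\<beta> z\<close>, which completes the sum
  over all vertices, and that is zero.\<close>

lemma wf_tip_net: "wf_net tip_net"
proof -
  have z: "z \<in> verts G" using canvas by (simp add: canvas_def)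
  have "(of_int (\<Sum>v\<in>verts G - {z}. bdz v) :: 3) =
      (\<Sum>v\<in>verts G - {z}. \<beta> v) + of_nat (outdeg tip_edges \<psi> z) - of_nat (indeg tip_edges \<psi> z)"
    by (simp add: of_int_bdz outdeg_z indeg_z sum.distrib sum_subtractf)
  also have "\<dots> = (\<Sum>v\<in>verts G - {z}. \<beta> v) + \<beta> z"
    using preflow by (simp add: tip_preflow_def add_diff_eq[symmetric])
  also have "\<dots> = (\<Sum>v\<in>verts G. \<beta> v)" using z by (simp add: sum.remove add.commute)
  also have "\<dots> = 0" using canvas by (intro sum_components) (auto simp: canvas_def)
  finally have "3 dvd (\<Sum>v\<in>verts G - {z}. bdz v)" by (simp only: of_int_Z3_eq_0_iff)
  moreover have "fst (ref e) \<in> verts G - {z} \<and> snd (ref e) \<in> verts G - {z}" if "e \<in> edges G - tip_edges" for e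
    using that ends_props[of e] by (auto simp: incident_edges_def)
  ultimately show ?thesis by (simp add: wf_net_def)
qed

text \<open>The sign 1 keeps the reference direction and -1 reverses it. At \<open>z\<close> only
  tip edges count, and the preflow balances them; elsewhere the tip edges contribute what
  \<open>bdz\<close> has set aside.\<close>

lemma extends:
  assumes f: "flow tip_net f"
  shows "extends_to_flow G \<beta> z \<psi>"
proof -
  define \<phi> where "\<phi> e = (if e \<in> tip_edges then \<psi> e else if f e = 1 then ref e else (snd (ref e), fst (ref e)))" for e
  have or: "orientation_on G (edges G) \<phi>"
    unfolding orientation_on_def
  proof
    fix e assume e: "e \<in> edges G"
    show "{fst (\<phi> e), snd (\<phi> e)} = ends G e"
      using preflow ends_props(1)[OF e]
      by (auto simp: \<phi>_def tip_preflow_def orientation_on_def)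
  qed
  have split: "(\<Sum>e\<in>edges G. g e) = (\<Sum>e\<in>edges G - tip_edges. g e) + (\<Sum>e\<in>tip_edges. g e)" for g :: "'e \<Rightarrow> nat"
    by (intro sum.subset_diff) (auto simp: incident_edges_def)
  have tip_edges: "(\<Sum>e\<in>tip_edges. of_bool (fst (\<phi> e) = v)) = outdeg tip_edges \<psi> v" "(\<Sum>e\<in>tip_edges. of_bool (snd (\<phi> e) = v)) = indeg tip_edges \<psi> v" for v
    unfolding outdeg_def indeg_def card_filter[OF fin(3)] by (auto simp: \<phi>_def intro!: sum.cong)
  have out: "outdeg (edges G) \<phi> v = (\<Sum>e\<in>edges G - tip_edges. of_bool (fst (\<phi> e) = v)) + outdeg tip_edges \<psi> v"
    and inn: "indeg (edges G) \<phi> v = (\<Sum>e\<in>edges G - tip_edges. of_bool (snd (\<phi> e) = v)) + indeg tip_edges \<psi> v" for v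
    unfolding tip_edges[symmetric] split[symmetric] by (simp_all only: outdeg_def indeg_def card_filter[OF fin(2)])
  have rest: "(of_nat (\<Sum>e\<in>edges G - tip_edges. of_bool (fst (\<phi> e) = v)) :: 3) - of_nat (\<Sum>e\<in>edges G - tip_edges. of_bool (snd (\<phi> e) = v))
     = of_int (\<Sum>e\<in>edges G - tip_edges. f e * inc tip_net e v)" for v
  proof -
    have "int (\<Sum>e\<in>edges G - tip_edges. of_bool (fst (\<phi> e) = v)) - int (\<Sum>e\<in>edges G - tip_edges. of_bool (snd (\<phi> e) = v))
      = (\<Sum>e\<in>edges G - tip_edges. of_bool (fst (\<phi> e) = v) - of_bool (snd (\<phi> e) = v))"
      by (simp only: of_nat_sum of_nat_of_bool sum_subtractf)
    also have "\<dots> = (\<Sum>e\<in>edges G - tip_edges. f e * inc tip_net e v)"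
    proof (rule sum.cong[OF refl])
      fix e assume e: "e \<in> edges G - tip_edges"
      then have "f e = 1 \<or> f e = -1" using f by (simp add: flow_def)
      then show "of_bool (fst (\<phi> e) = v) - of_bool (snd (\<phi> e) = v) = f e * inc tip_net e v"
        using e by (auto simp: \<phi>_def inc_def)
    qed
    finally have "of_int (int (\<Sum>e\<in>edges G - tip_edges. of_bool (fst (\<phi> e) = v)) - int (\<Sum>e\<in>edges G - tip_edges. of_bool (snd (\<phi> e) = v)))
      = (of_int (\<Sum>e\<in>edges G - tip_edges. f e * inc tip_net e v) :: 3)" by (rule arg_cong)
    then show ?thesis by (simp only: of_int_diff of_int_of_nat_eq)
  qed
  have "of_nat (outdeg (edges G) \<phi> v) - of_nat (indeg (edges G) \<phi> v) = \<beta> v" if v: "v \<in> verts G" for v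
  proof (cases "v = z")
    case True
    have "inc tip_net e z = 0" if "e \<in> edges G - tip_edges" for e
      using that ends_props[of e] by (auto simp: inc_def incident_edges_def)
    then have "(\<Sum>e\<in>edges G - tip_edges. f e * inc tip_net e z) = 0" by (intro sum.neutral) auto
    then have "(of_nat (\<Sum>e\<in>edges G - tip_edges. of_bool (fst (\<phi> e) = z)) :: 3) - of_nat (\<Sum>e\<in>edges G - tip_edges. of_bool (snd (\<phi> e) = z)) = 0"
      unfolding rest by simp
    then show ?thesis using preflow unfolding True out inn of_nat_add tip_preflow_def
      by (metis (no_types, lifting) add_diff_add add_0)
  next
    case False
    have "fst (\<psi> e) = v \<longleftrightarrow> fst (\<psi> e) = v \<and> snd (\<psi> e) = z"
      "snd (\<psi> e) = v \<longleftrightarrow> fst (\<psi> e) = z \<and> snd (\<psi> e) = v" if e: "e \<in> tip_edges" for e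
    proof -
      obtain w where "\<psi> e = (z, w) \<or> \<psi> e = (w, z)" using tip_edges_props(2)[OF e] by blast
      then show "fst (\<psi> e) = v \<longleftrightarrow> fst (\<psi> e) = v \<and> snd (\<psi> e) = z"
        "snd (\<psi> e) = v \<longleftrightarrow> fst (\<psi> e) = z \<and> snd (\<psi> e) = v"
        using False by (elim disjE; simp)+
    qed
    then have "outdeg tip_edges \<psi> v = outof v" "indeg tip_edges \<psi> v = into v"
      unfolding outdeg_def indeg_def outof_def into_def by (metis (mono_tags, lifting) Collect_cong)+
    moreover have "(of_int (\<Sum>e\<in>edges G - tip_edges. f e * inc tip_net e v) :: 3) = of_int (bdz v)"
    proof -
      have "3 dvd (\<Sum>e\<in>edges G - tip_edges. f e * inc tip_net e v) - bdz v" using f v False by (simp add: flow_def)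
      then have "(of_int ((\<Sum>e\<in>edges G - tip_edges. f e * inc tip_net e v) - bdz v) :: 3) = 0" by (simp only: of_int_Z3_eq_0_iff)
      then show ?thesis by (simp only: of_int_diff right_minus_eq)
    qed
    ultimately have "(of_nat (\<Sum>e\<in>edges G - tip_edges. of_bool (fst (\<phi> e) = v)) :: 3) - of_nat (\<Sum>e\<in>edges G - tip_edges. of_bool (snd (\<phi> e) = v))
      = \<beta> v + of_nat (indeg tip_edges \<psi> v) - of_nat (outdeg tip_edges \<psi> v)"
      unfolding rest by (simp only: of_int_bdz)
    then show ?thesis unfolding out inn of_nat_add by (simp add: algebra_simps del: of_nat_sum sum_of_bool_eq)
  qed
  then have "nowhere_zero_flow G \<beta> \<phi>" using or by (simp add: nowhere_zero_flow_def)
  then show ?thesis unfolding extends_to_flow_def by (intro exI[of _ \<phi>]) (auto simp: \<phi>_def)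
qed

end

theorem mainTheorem3:
  fixes G :: "('v, 'e) mgraph" and \<beta> :: "'v \<Rightarrow> 3" and z :: 'v
  assumes "canvas G \<beta> z"
    and "\<forall>A. A \<noteq> {} \<and> A \<subset> verts G - {z} \<longrightarrow> deg G A \<ge> 4 + abs_tau G \<beta> A"
    and "\<exists>x\<in>verts G - {z}. \<forall>X. X \<subseteq> verts G - {z} \<and> x \<in> X \<longrightarrow>
           int (deg G X) > int (vdeg G z) - 2"
  shows "\<forall>\<psi>. tip_preflow G \<beta> z \<psi> \<longrightarrow> extends_to_flow G \<beta> z \<psi>"
proof (intro allI impI)
  fix \<psi> assume "tip_preflow G \<beta> z \<psi>"
  then interpret preflow_net G \<beta> z \<psi> using assms(1) by unfold_locales
  have "good tip_net"
    unfolding good_def sel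
  proof (intro allI impI)
    fix X assume X: "X \<subseteq> verts G - {z}" "X \<noteq> {} \<and> X \<noteq> verts G - {z}"
    then have "deg G X \<ge> 4 + abs_tau G \<beta> X" using assms(2) by blast
    moreover have "(\<Sum>v\<in>X. \<beta> v) = 0 \<longleftrightarrow> 3 dvd bet tip_net X"
      using of_int_bet[OF X(1)] of_int_Z3_eq_0_iff by metis
    \<comment> \<open>By parity the bound only excludes degrees below 4, degree 4 with nonzero
      boundary and degree 5 with zero boundary.\<close>
    ultimately show "fine (dgr tip_net X) (bet tip_net X)"
      unfolding dgr_tip_net[OF X(1)] fine_def abs_tau_def by (auto split: if_splits)
  qed
  moreover have "anchored tip_net (nV tip_net) (tipdeg tip_net)"
  proof -
    obtain x where x: "x \<in> verts G - {z}"
      "\<And>X. X \<subseteq> verts G - {z} \<Longrightarrow> x \<in> X \<Longrightarrow> int (deg G X) > int (vdeg G z) - 2"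
      using assms(3) by blast
    have "tipdeg tip_net \<le> dgr tip_net X + 1" if "X \<subseteq> verts G - {z}" "x \<in> X" for X
      using x(2)[OF that] unfolding dgr_tip_net[OF that(1)] tipdeg_tip_net by linarith
    then show ?thesis unfolding anchored_def sel using x(1) by blast
  qed
  ultimately have "admissible tip_net" using wf_tip_net by (simp add: admissible_def)
  then show "extends_to_flow G \<beta> z \<psi>" using admissible_flow extends by blast
qed

end
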